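(* Let $\lambda>0$, let $G$ be a probability distribution on $(0,\infty)$, and let $(V_t^{2,x})_{t\ge0}$, $x\ge0$, be the Model 2 workload process with arrival rate $\lambda$ and service distribution $G$. If $\mathbb{E}(S_1)<\infty$, then the process has an invariant distribution $\pi$ on $[0,\infty)$, and $\pi$ has a density $\tilde\pi$ on $(0,\infty)$ given by $$\tilde{\pi}(x)=\begin{cases} \dfrac{\sum_{i=1}^{\infty}\lambda^{i}\bar{G}^{\ast i}(x)}{1+\lambda\,\mathbb{E}(S_1)\bigl(1+\sum_{i=1}^{\infty}\lambda^{i}\int_{0}^{1}\bar{G}^{\ast i}(y)\,dy\bigr)}, & x\in(0,1],\\[3ex] \dfrac{\lambda\bar{G}(x)+\lambda\sum_{i=1}^{\infty}\lambda^{i}\int_{0}^{1}\bar{G}(x-y)\,\bar{G}^{\ast i}(y)\,dy}{1+\lambda\,\mathbb{E}(S_1)\bigl(1+\sum_{i=1}^{\infty}\lambda^{i}\int_{0}^{1}\bar{G}^{\ast i}(y)\,dy\bigr)}, & x\in(1,\infty). \end{cases}$$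
   Context: Model 2 (M/G/1 workload with bounded waiting time, threshold 1). Let $T_0=0$ and let the inter-arrival times $T_i-T_{i-1}$, $i\ge1$, be i.i.d. exponential with mean $1/\lambda$; let $(S_n)_{n\ge1}$ be i.i.d. with distribution $G$ on $(0,\infty)$, independent of $(T_n)$. For $x\ge0$ define $V^{2,x}_0=x$, $$V^{2,x}_t=\max[V^{2,x}_{T_{n-1}}-(t-T_{n-1}),0]\quad(T_{n-1}\le t<T_n,\ n\ge1),\qquad V^{2,x}_{T_n}=V^{2,x}_{T_n-}+S_n\mathbf{1}_{\{V^{2,x}_{T_n-}<1\}}\quad(n\ge1),$$ where $V^{2,x}_{T_n-}$ is the left limit at $T_n$. The invariant distribution has an atom at $0$ in addition to its density on $(0,\infty)$. Notation: $\bar G(x)=1-G(x)=\mathbb{P}(S_1>x)$, where $G(x)$ also denotes the distribution function. For functions on $[0,\infty)$, $(f\ast g)(x)=\int_0^x f(x-y)g(y)\,dy$; $\bar G^{\ast 1}=\bar G$ and $\bar G^{\ast (i+1)}=\bar G\ast\bar G^{\ast i}$. *)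

theory Defs
  imports "HOL-Probability.Probability"
begin

text \<open>
  The workload path driven by arrival epochs \<open>0 = T 0 < T 1 < \<dots>\<close> and services \<open>S 1, S 2, \<dots>\<close>
  (\<open>S 0\<close> is not used). \<open>workload_arr T S x n\<close> is the workload at time \<open>T n\<close>; the local variable
  \<open>v\<close> is its left limit at \<open>T (Suc n)\<close>. That these definitions satisfy the defining recursion of
  the process, with the left limit taken literally, is lemmas \<open>workload_zero\<close>,
  \<open>workload_between\<close> and \<open>workload_jump\<close>.
\<close>

primrec workload_arr :: "(nat \<Rightarrow> real) \<Rightarrow> (nat \<Rightarrow> real) \<Rightarrow> real \<Rightarrow> nat \<Rightarrow> real" where
  "workload_arr T S x 0 = x"
| "workload_arr T S x (Suc n) =
     (let v = max (workload_arr T S x n - (T (Suc n) - T n)) 0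
      in v + (if v < 1 then S (Suc n) else 0))"

text \<open>
  If infinitely many epochs precede \<open>t\<close>, \<open>card\<close> is 0 and the value is meaningless; for Poisson
  arrivals this has probability 0.
\<close>

definition arrivals :: "(nat \<Rightarrow> real) \<Rightarrow> real \<Rightarrow> nat" where
  "arrivals T t = card {k. 1 \<le> k \<and> T k \<le> t}"

definition workload :: "(nat \<Rightarrow> real) \<Rightarrow> (nat \<Rightarrow> real) \<Rightarrow> real \<Rightarrow> real \<Rightarrow> real" where
  "workload T S x t =
     max (workload_arr T S x (arrivals T t) - (t - T (arrivals T t))) 0"

lemma arrivals_eq:
  assumes "strict_mono T" "T n \<le> t" "t < T (Suc n)"
  shows "arrivals T t = n"
proof -
  have "T k \<le> t \<longleftrightarrow> k \<le> n" for k
  proof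
    assume "T k \<le> t"
    with assms(3) have "T k < T (Suc n)" by linarith
    then show "k \<le> n" using assms(1) by (simp add: strict_mono_less)
  next
    assume "k \<le> n"
    then have "T k \<le> T n" using assms(1) by (simp add: strict_mono_less_eq)
    then show "T k \<le> t" using assms(2) by linarith
  qed
  then have "{k. 1 \<le> k \<and> T k \<le> t} = {1..n}" unfolding set_eq_iff by simp
  then show ?thesis by (simp add: arrivals_def)
qed

lemma workload_arr_nonneg:
  assumes "x \<ge> 0" "\<And>n. n \<ge> 1 \<Longrightarrow> S n \<ge> 0"
  shows "workload_arr T S x n \<ge> 0"
proof (cases n)
  case (Suc m)
  then show ?thesis using assms(2)[of "Suc m"] by (simp add: Let_def)
qed (simp add: assms(1))

lemma workload_at_arrival:
  assumes "strict_mono T" "x \<ge> 0" "\<And>n. n \<ge> 1 \<Longrightarrow> S n \<ge> 0"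
  shows "workload T S x (T n) = workload_arr T S x n"
proof -
  have "arrivals T (T n) = n"
    using assms(1) by (intro arrivals_eq) (auto simp: strict_mono_less)
  then show ?thesis
    using workload_arr_nonneg[OF assms(2,3)] by (simp add: workload_def)
qed

lemma workload_zero:
  assumes "strict_mono T" "T 0 = 0" "x \<ge> 0" "\<And>n. n \<ge> 1 \<Longrightarrow> S n \<ge> 0"
  shows "workload T S x 0 = x"
  using workload_at_arrival[OF assms(1,3,4), where n = 0] assms(2) by simp

lemma workload_between:
  assumes "strict_mono T" "x \<ge> 0" "\<And>n. n \<ge> 1 \<Longrightarrow> S n \<ge> 0"
    and "T n \<le> t" "t < T (Suc n)"
  shows "workload T S x t = max (workload T S x (T n) - (t - T n)) 0"
proof -
  have "workload T S x (T n) = workload_arr T S x n"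
    using workload_at_arrival assms(1-3) by blast
  then show ?thesis
    by (simp add: workload_def[of T S x t] arrivals_eq[OF assms(1,4,5)])
qed

lemma workload_jump:
  assumes "strict_mono T" "x \<ge> 0" "\<And>n. n \<ge> 1 \<Longrightarrow> S n \<ge> 0"
  obtains v where "(workload T S x \<longlongrightarrow> v) (at_left (T (Suc n)))"
    and "workload T S x (T (Suc n)) = v + S (Suc n) * of_bool (v < 1)"
proof
  let ?f = "\<lambda>t. max (workload T S x (T n) - (t - T n)) 0"
  have lt: "T n < T (Suc n)" using assms(1) by (simp add: strict_mono_less)
  have "(?f \<longlongrightarrow> ?f (T (Suc n))) (at_left (T (Suc n)))"
    by (intro tendsto_intros)
  moreover have "\<forall>\<^sub>F t in at_left (T (Suc n)). ?f t = workload T S x t"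
    using eventually_at_left_real[OF lt]
    by eventually_elim (rule workload_between[OF assms(1-3), symmetric], auto)
  ultimately show "(workload T S x \<longlongrightarrow> ?f (T (Suc n))) (at_left (T (Suc n)))"
    by (rule Lim_transform_eventually)
  show "workload T S x (T (Suc n)) = ?f (T (Suc n)) + S (Suc n) * of_bool (?f (T (Suc n)) < 1)"
    by (simp add: workload_at_arrival[OF assms] Let_def)
qed

locale mg1 = prob_space M for M :: "'a measure" +
  fixes lam :: real and G :: "real measure" and T S :: "nat \<Rightarrow> 'a \<Rightarrow> real"
  assumes lam_pos: "lam > 0"
    and prob_G: "prob_space G" and sets_G: "sets G = sets borel"
    and G_pos: "emeasure G {..0} = 0"
    and T_0: "\<And>\<omega>. \<omega> \<in> space M \<Longrightarrow> T 0 \<omega> = 0"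
    and interarrival_indep: "indep_vars (\<lambda>_. borel) (\<lambda>n \<omega>. T n \<omega> - T (n - 1) \<omega>) {1..}"
    and interarrival_exp:
      "\<And>n. n \<ge> 1 \<Longrightarrow> distributed M lborel (\<lambda>\<omega>. T n \<omega> - T (n - 1) \<omega>) (exponential_density lam)"
    and S_indep: "indep_vars (\<lambda>_. borel) S {1..}"
    and S_distr: "\<And>n. n \<ge> 1 \<Longrightarrow> distr M borel (S n) = G"
    and T_S_indep: "indep_var (Pi\<^sub>M UNIV (\<lambda>_. borel)) (\<lambda>\<omega> n. T n \<omega>)
                             (Pi\<^sub>M {1..} (\<lambda>_. borel)) (\<lambda>\<omega>. \<lambda>n\<in>{1..}. S n \<omega>)"
begin

definition V :: "real \<Rightarrow> real \<Rightarrow> 'a \<Rightarrow> real" where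
  "V x t \<omega> = workload (\<lambda>n. T n \<omega>) (\<lambda>n. S n \<omega>) x t"

end

text \<open>
  Here \<open>X x t\<close> is the state at time \<open>t\<close> of the process started at \<open>x\<close>: the condition is
  \<open>\<integral> P(X x t \<in> A) \<pi>(dx) = \<pi>(A)\<close> for all \<open>t \<ge> 0\<close> and Borel \<open>A\<close>.
\<close>

definition invariant_distribution ::
  "'a measure \<Rightarrow> (real \<Rightarrow> real \<Rightarrow> 'a \<Rightarrow> real) \<Rightarrow> real measure \<Rightarrow> bool" where
  "invariant_distribution M X \<pi> \<longleftrightarrow>
     prob_space \<pi> \<and> sets \<pi> = sets borel \<and> emeasure \<pi> {..<0} = 0 \<and>
     (\<forall>t\<ge>0. \<forall>A\<in>sets borel.
        (\<integral>\<^sup>+x. emeasure M {\<omega> \<in> space M. X x t \<omega> \<in> A} \<partial>\<pi>) = emeasure \<pi> A)"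

definition has_density_on :: "real measure \<Rightarrow> (real \<Rightarrow> real) \<Rightarrow> real set \<Rightarrow> bool" where
  "has_density_on \<pi> f A \<longleftrightarrow>
     f \<in> borel_measurable (restrict_space borel A) \<and> (\<forall>x\<in>A. 0 \<le> f x) \<and>
     (\<forall>B\<in>sets borel. B \<subseteq> A \<longrightarrow> emeasure \<pi> B = (\<integral>\<^sup>+x\<in>B. ennreal (f x) \<partial>lborel))"

definition tail :: "real measure \<Rightarrow> real \<Rightarrow> real" where
  "tail G x = measure G {x<..}"

definition conv :: "(real \<Rightarrow> real) \<Rightarrow> (real \<Rightarrow> real) \<Rightarrow> real \<Rightarrow> real" where
  "conv f g x = (LBINT y:{0..x}. f (x - y) * g y)"

text \<open>The value at exponent 0 is a dummy: only exponents \<open>i \<ge> 1\<close> are meaningful.\<close>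

fun conv_power :: "(real \<Rightarrow> real) \<Rightarrow> nat \<Rightarrow> real \<Rightarrow> real" where
  "conv_power f 0 = (\<lambda>_. 0)"
| "conv_power f (Suc 0) = f"
| "conv_power f (Suc (Suc i)) = conv f (conv_power f (Suc i))"

text \<open>
  The parameter \<open>m\<close> is the mean service time. The series over \<open>i \<ge> 1\<close> are written with \<open>Suc i\<close>;
  they converge, since \<open>0 \<le> conv_power (tail G) (Suc i) x \<le> x ^ i / fact i\<close> for \<open>x \<ge> 0\<close>.
\<close>

definition norm_const :: "real \<Rightarrow> real measure \<Rightarrow> real \<Rightarrow> real" where
  "norm_const lam G m =
     1 + lam * m * (1 + (\<Sum>i. lam ^ Suc i * (LBINT y:{0..1}. conv_power (tail G) (Suc i) y)))"

definition pi_density :: "real \<Rightarrow> real measure \<Rightarrow> real \<Rightarrow> real \<Rightarrow> real" where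
  "pi_density lam G m x =
     (if x \<le> 1
      then (\<Sum>i. lam ^ Suc i * conv_power (tail G) (Suc i) x) / norm_const lam G m
      else (lam * tail G x
            + lam * (\<Sum>i. lam ^ Suc i *
                (LBINT y:{0..1}. tail G (x - y) * conv_power (tail G) (Suc i) y)))
           / norm_const lam G m)"

end

theory Submission
  imports Defs
begin

text \<open>
  Write \<open>q = (\<Sum>i\<ge>1. lam^i tail^{*i})\<close> and \<open>p x = lam * tail x + lam * \<integral>{0..min x 1} tail (x - y) q y\<close>, so
  that \<open>p = q\<close> on \<open>(0, 1]\<close>; the claimed density is \<open>p / C\<close>, and \<open>1 / C\<close> is the mass of the atom at 0.
  The identity for \<open>p\<close> says that, under this law, level \<open>x\<close> is upcrossed by jumps at the same rate
  \<open>p x / C\<close> at which it is downcrossed by the unit drift. Integrating it along the drift shows that the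
  law equals its own decomposition at the last arrival before time \<open>t\<close>, where the state
  just before an arrival is again distributed according to the law.

  Consider the Markov chain (workload, epoch) observed at arrivals, started from the law at epoch 0.
  By this decomposition, telescoping bounds the sum over all arrivals of the means of a function \<open>g\<close>
  by the mean of \<open>g\<close> summed over a stream of arrivals with intensity \<open>lam dt\<close> whose states have the
  stationary post-jump law. Applied to the probability of no further arrival before \<open>t\<close> this
  gives \<open>\<integral> P(V x t \<in> A) \<pi>(dx) \<le> \<pi> A\<close> for every \<open>A\<close>; both sides have total mass 1, so
  equality holds.
\<close>

section \<open>Bounded integrands on compact intervals\<close>

text \<open>The bridge between the real-valued set integrals of the claimed formulas and the
  nonnegative integrals in which the argument runs. Bounds are asked for only on the interval,
  because convolution powers are controlled only at nonnegative arguments.\<close>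

lemma
  fixes f :: "real \<Rightarrow> real"
  assumes [measurable]: "f \<in> borel_measurable borel"
    and bnd: "\<And>y. y \<in> {0..c} \<Longrightarrow> 0 \<le> f y \<and> f y \<le> B"
  shows set_integrable_bounded_nonneg: "set_integrable lborel {0..c} f"
    and nn_integral_eq_set_integral_bounded:
      "ennreal (LBINT y:{0..c}. f y) = (\<integral>\<^sup>+y. ennreal (f y) * indicator {0..c} y \<partial>lborel)"
proof -
  show int: "set_integrable lborel {0..c} f"
    unfolding set_integrable_def
  proof (rule Bochner_Integration.integrable_bound)
    show "integrable lborel (\<lambda>y. indicator {0..c} y *\<^sub>R B)"
      by (rule integrable_scaleR_left[OF integrable_real_indicator]) (auto simp: emeasure_lborel_Icc_eq)
    show "AE y in lborel. norm (indicator {0..c} y *\<^sub>R f y) \<le> norm (indicator {0..c} y *\<^sub>R B)"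
      using bnd by (intro AE_I2) (force simp: indicator_def)
  qed simp
  have "(\<integral>\<^sup>+y. ennreal (f y) * indicator {0..c} y \<partial>lborel)
      = (\<integral>\<^sup>+y. ennreal (indicator {0..c} y *\<^sub>R f y) \<partial>lborel)"
    by (intro nn_integral_cong) (auto simp: indicator_def)
  also have "\<dots> = ennreal (LBINT y:{0..c}. f y)"
    unfolding set_lebesgue_integral_def
    by (rule nn_integral_eq_integral[OF int[unfolded set_integrable_def]])
       (use bnd in \<open>auto simp: indicator_def\<close>)
  finally show "ennreal (LBINT y:{0..c}. f y) = (\<integral>\<^sup>+y. ennreal (f y) * indicator {0..c} y \<partial>lborel)" ..
qed

lemma set_integral_le_bound:
  fixes f :: "real \<Rightarrow> real"
  assumes "f \<in> borel_measurable borel" "\<And>y. y \<in> {0..c} \<Longrightarrow> 0 \<le> f y \<and> f y \<le> B" "0 \<le> c"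
  shows "0 \<le> (LBINT y:{0..c}. f y)" "(LBINT y:{0..c}. f y) \<le> B * c"
proof -
  show "0 \<le> (LBINT y:{0..c}. f y)"
    unfolding set_lebesgue_integral_def
    by (intro Bochner_Integration.integral_nonneg) (use assms(2) in \<open>auto simp: indicator_def\<close>)
  have "0 \<le> B" using assms(2)[of 0] assms(3) by auto
  then have "set_integrable lborel {0..c} (\<lambda>_. B)"
    by (intro set_integrable_bounded_nonneg) auto
  then have "(LBINT y:{0..c}. f y) \<le> (LBINT y:{0..c}. B)"
    using set_integrable_bounded_nonneg[OF assms(1,2)] assms(2) by (intro set_integral_mono) auto
  also have "\<dots> = B * c"
    using assms(3) by (simp add: set_lebesgue_integral_def)
  finally show "(LBINT y:{0..c}. f y) \<le> B * c" .
qed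

section \<open>Tails and convolution powers of the service law\<close>

text \<open>Everything that depends only on \<open>lam\<close> and \<open>G\<close> is developed
  here, without the probability space of the queue; that space enters when the locale is interpreted
  inside \<open>mg1_integrable\<close>.\<close>

locale service_law = prob_space G for G :: "real measure" +
  fixes lam :: real
  assumes lam_pos: "lam > 0"
    and sets_G [measurable_cong]: "sets G = sets borel"
    and G_pos: "emeasure G {..0} = 0"
    and integrable_G: "integrable G (\<lambda>y. y)"
begin

lemma space_G [simp]: "space G = UNIV"
  using sets_eq_imp_space_eq[OF sets_G] by simp

lemma AE_G_pos: "AE y in G. y > 0"
  by (rule AE_I[where N = "{..0}"]) (auto simp: G_pos sets_G)

lemma tail_bounds: "0 \<le> tail G x" "tail G x \<le> 1"
  by (simp_all add: tail_def)

lemma tail_nonpos: "x \<le> 0 \<Longrightarrow> tail G x = 1"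
  unfolding tail_def by (intro prob_eq_1[THEN iffD2]) (use AE_G_pos in \<open>auto simp: sets_G\<close>)

lemma tail_measurable [measurable]: "tail G \<in> borel_measurable borel"
proof -
  have "mono (\<lambda>x. - tail G x)"
    unfolding tail_def by (intro monoI) (auto intro!: finite_measure_mono simp: sets_G)
  then have "(\<lambda>x. - tail G x) \<in> borel_measurable borel"
    by (rule borel_measurable_mono)
  then show ?thesis
    using borel_measurable_uminus_eq by blast
qed

lemma conv_measurable:
  assumes [measurable]: "f \<in> borel_measurable borel"
  shows "conv (tail G) f \<in> borel_measurable borel"
proof -
  have [measurable]: "{p :: real \<times> real. 0 \<le> snd p \<and> snd p \<le> fst p} \<in> sets (borel \<Otimes>\<^sub>M borel)"
  proof -
    have "{p \<in> space (borel \<Otimes>\<^sub>M borel). 0 \<le> snd p \<and> snd p \<le> fst p} \<in> sets (borel \<Otimes>\<^sub>M (borel :: real measure))"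
      by measurable
    then show ?thesis by (simp add: space_pair_measure)
  qed
  \<comment> \<open>The range of integration depends on \<open>x\<close>; an indicator on the plane
    turns it into an integral over the whole line with a jointly measurable integrand.\<close>
  have "(\<lambda>x. \<integral>y. indicator {p. 0 \<le> snd p \<and> snd p \<le> fst p} (x, y) *\<^sub>R (tail G (x - y) * f y) \<partial>lborel)
      \<in> borel_measurable borel"
    by measurable
  also have "(\<lambda>x. \<integral>y. indicator {p. 0 \<le> snd p \<and> snd p \<le> fst p} (x, y) *\<^sub>R (tail G (x - y) * f y) \<partial>lborel)
      = conv (tail G) f"
    by (auto simp: fun_eq_iff conv_def set_lebesgue_integral_def indicator_def intro!: Bochner_Integration.integral_cong)
  finally show ?thesis .
qed

text \<open>The index is shifted by one, which leaves out the dummy exponent 0: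
  \<open>tail_power i\<close> is the convolution power with \<open>i + 1\<close> factors.\<close>

abbreviation tail_power :: "nat \<Rightarrow> real \<Rightarrow> real" where
  "tail_power i \<equiv> conv_power (tail G) (Suc i)"

lemma tail_power_measurable [measurable]: "tail_power i \<in> borel_measurable borel"
  by (induction i) (simp_all add: conv_measurable)

text \<open>Since \<open>tail G\<close> is at most 1, a further convolution costs at most one
  integration, which takes \<open>y ^ i / fact i\<close> to the same expression with
  \<open>i + 1\<close>. The factorials make every series below converge for every
  \<open>lam\<close>.\<close>

lemma tail_power_bounds: "0 \<le> x \<Longrightarrow> 0 \<le> tail_power i x \<and> tail_power i x \<le> x ^ i / fact i"
proof (induction i arbitrary: x)
  case 0
  then show ?case using tail_bounds by simp
next
  case (Suc i)
  let ?f = "\<lambda>y. tail G (x - y) * tail_power i y" and ?g = "\<lambda>y. y ^ i / fact i :: real"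
  have b: "0 \<le> ?f y \<and> ?f y \<le> ?g y" if "y \<in> {0..x}" for y
  proof -
    have "?f y \<le> 1 * ?g y"
      using Suc.IH[of y] that tail_bounds by (intro mult_mono) auto
    then show ?thesis using Suc.IH[of y] that tail_bounds by auto
  qed
  have g: "0 \<le> ?g y \<and> ?g y \<le> x ^ i / fact i" if "y \<in> {0..x}" for y
    using that by (auto intro!: divide_right_mono power_mono)
  have "0 \<le> (LBINT y:{0..x}. ?f y)"
    unfolding set_lebesgue_integral_def
    by (intro Bochner_Integration.integral_nonneg) (use b in \<open>auto simp: indicator_def\<close>)
  moreover have "(LBINT y:{0..x}. ?f y) \<le> (LBINT y:{0..x}. ?g y)"
  proof (rule set_integral_mono)
    show "set_integrable lborel {0..x} ?f"
      by (rule set_integrable_bounded_nonneg[where B = "x ^ i / fact i"]) (use b g in force)+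
    show "set_integrable lborel {0..x} ?g"
      by (rule set_integrable_bounded_nonneg[where B = "x ^ i / fact i"]) (use g in force)+
  qed (use b in auto)
  moreover have "(LBINT y:{0..x}. ?g y) = (\<integral>y. y ^ i * indicator {0..x} y / fact i \<partial>lborel)"
    unfolding set_lebesgue_integral_def
    by (intro Bochner_Integration.integral_cong) (auto simp: indicator_def)
  moreover have "\<dots> = x ^ Suc i / Suc i / fact i"
    using integral_power[of 0 x i] Suc.prems by (simp del: of_nat_Suc)
  moreover have "x ^ Suc i / Suc i / fact i = x ^ Suc i / fact (Suc i)"
    by (simp add: field_simps)
  ultimately show ?case
    by (simp add: conv_def)
qed

lemma tail_power_nonneg: "0 \<le> x \<Longrightarrow> 0 \<le> tail_power i x"
  using tail_power_bounds by blast

lemma tail_power_le_inverse_fact: "0 \<le> x \<Longrightarrow> x \<le> 1 \<Longrightarrow> tail_power i x \<le> 1 / fact i"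
proof -
  assume x: "0 \<le> x" "x \<le> 1"
  have "tail_power i x \<le> x ^ i / fact i" using tail_power_bounds x by blast
  also have "\<dots> \<le> 1 / fact i"
    using x by (intro divide_right_mono) (auto simp: power_le_one)
  finally show ?thesis .
qed

text \<open>Comparison with the exponential series at \<open>lam * x\<close>.\<close>

lemma summable_scaled:
  assumes "\<And>i. 0 \<le> g i" "\<And>i. g i \<le> x ^ i / fact i"
  shows "summable (\<lambda>i. lam ^ Suc i * g i)"
proof (rule summable_comparison_test')
  show "summable (\<lambda>i. lam * (inverse (fact i) * (lam * x) ^ i))"
    by (intro summable_mult summable_exp)
  show "norm (lam ^ Suc n * g n) \<le> lam * (inverse (fact n) * (lam * x) ^ n)" for n
  proof -
    have "lam ^ Suc n * g n \<le> lam ^ Suc n * (x ^ n / fact n)"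
      using lam_pos assms by (intro mult_left_mono) auto
    then show ?thesis
      using lam_pos assms(1)[of n] by (simp add: field_simps abs_mult)
  qed
qed

section \<open>The renewal series and the unnormalised density\<close>

text \<open>The \<open>q\<close> of the overview, with values in \<open>ennreal\<close> so that sums
  and integrals can be exchanged by monotone convergence.\<close>

definition renewal :: "real \<Rightarrow> ennreal" where
  "renewal y = (\<Sum>i. ennreal (lam ^ Suc i * tail_power i y))"

text \<open>
  Up to the factor \<open>1 / C\<close>, \<open>upcross x\<close> is the probability that a jump from the stationary state crosses \<open>x\<close>:
  the two terms are the contributions of the atom at 0 and of the density on \<open>(0, 1)\<close>.
\<close>

definition upcross :: "real \<Rightarrow> ennreal" where
  "upcross x = ennreal (tail G x) +
     (\<integral>\<^sup>+y. ennreal (tail G (x - y)) * renewal y * indicator {0..min x 1} y \<partial>lborel)"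

text \<open>The \<open>p\<close> of the overview: arrivals come at rate \<open>lam\<close>, so this
  is a rate of upcrossings, still without the factor \<open>1 / C\<close>.\<close>

definition raw_density :: "real \<Rightarrow> ennreal" where
  "raw_density x = ennreal lam * upcross x"

abbreviation C :: real where
  "C \<equiv> norm_const lam G (expectation (\<lambda>y. y))"

lemma renewal_measurable [measurable]: "renewal \<in> borel_measurable borel"
  unfolding renewal_def by measurable

lemma renewal_eq: "0 \<le> y \<Longrightarrow> renewal y = ennreal (\<Sum>i. lam ^ Suc i * tail_power i y)"
  unfolding renewal_def using tail_power_bounds lam_pos
  by (intro suminf_ennreal2 summable_scaled[where x = y]) auto

lemma truncated_conv_measurable [measurable]:
  "(\<lambda>x. \<integral>\<^sup>+y. ennreal (tail G (x - y)) * renewal y * indicator {0..min x 1} y \<partial>lborel) \<in> borel_measurable borel"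
proof -
  have "(\<lambda>x. \<integral>\<^sup>+y. ennreal (tail G (x - y)) * renewal y *
      (if 0 \<le> y \<and> y \<le> x \<and> y \<le> 1 then 1 else 0) \<partial>lborel) \<in> borel_measurable borel"
    by measurable
  also have "(\<lambda>x. \<integral>\<^sup>+y. ennreal (tail G (x - y)) * renewal y * (if 0 \<le> y \<and> y \<le> x \<and> y \<le> 1 then 1 else 0) \<partial>lborel)
     = (\<lambda>x. \<integral>\<^sup>+y. ennreal (tail G (x - y)) * renewal y * indicator {0..min x 1} y \<partial>lborel)"
    by (intro ext nn_integral_cong) (auto simp: indicator_def)
  finally show ?thesis .
qed

lemma upcross_measurable [measurable]: "upcross \<in> borel_measurable borel"
  unfolding upcross_def by measurable

lemma raw_density_measurable [measurable]: "raw_density \<in> borel_measurable borel"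
  unfolding raw_density_def by measurable

text \<open>Only workloads below the threshold 1 admit a jump, hence the cut at
  \<open>min x 1\<close>. It merges the two cases of the claim: for \<open>x \<le> 1\<close> this is
  the next convolution power, for \<open>x > 1\<close> the integral over
  \<open>{0..1}\<close>.\<close>

abbreviation trunc_conv :: "nat \<Rightarrow> real \<Rightarrow> real" where
  "trunc_conv i x \<equiv> (LBINT y:{0..min x 1}. tail G (x - y) * tail_power i y)"

lemma tail_tail_power_bounds:
  assumes "y \<in> {0..min x 1}"
  shows "0 \<le> tail G (z - y) * tail_power i y \<and> tail G (z - y) * tail_power i y \<le> 1 / fact i"
proof -
  have "tail G (z - y) * tail_power i y \<le> 1 * (1 / fact i)"
    using tail_bounds tail_power_le_inverse_fact[of y i] tail_power_nonneg[of y i] assms by (intro mult_mono) auto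
  then show ?thesis
    using tail_bounds tail_power_nonneg[of y i] assms by auto
qed

lemma trunc_conv_bounds:
  assumes "0 < x"
  shows "0 \<le> trunc_conv i x" "trunc_conv i x \<le> 1 ^ i / fact i"
proof -
  note * = set_integral_le_bound[where f = "\<lambda>y. tail G (x - y) * tail_power i y" and B = "1 / fact i" and c = "min x 1"]
  show "0 \<le> trunc_conv i x"
    by (rule *) (use tail_tail_power_bounds assms in auto)
  have "trunc_conv i x \<le> (1 / fact i) * min x 1"
    by (rule *) (use tail_tail_power_bounds assms in auto)
  also have "\<dots> \<le> (1 / fact i) * 1"
    by (intro mult_left_mono) auto
  finally show "trunc_conv i x \<le> 1 ^ i / fact i" by simp
qed

text \<open>Monotone convergence moves the series out of the integral, and the factorial bounds make
  the resulting real series summable.\<close>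

lemma raw_density_eq:
  assumes "0 < x"
  shows "raw_density x = ennreal (lam * tail G x + lam * (\<Sum>i. lam ^ Suc i * trunc_conv i x))"
proof -
  have "(\<integral>\<^sup>+y. ennreal (tail G (x - y)) * renewal y * indicator {0..min x 1} y \<partial>lborel)
     = (\<integral>\<^sup>+y. (\<Sum>i. ennreal (lam ^ Suc i) * (ennreal (tail G (x - y) * tail_power i y) * indicator {0..min x 1} y)) \<partial>lborel)"
  proof (intro nn_integral_cong)
    fix y
    show "ennreal (tail G (x - y)) * renewal y * indicator {0..min x 1} y =
      (\<Sum>i. ennreal (lam ^ Suc i) * (ennreal (tail G (x - y) * tail_power i y) * indicator {0..min x 1} y))"
    proof (cases "y \<in> {0..min x 1}")
      case True
      then have "ennreal (tail G (x - y) * tail_power i y) = ennreal (tail G (x - y)) * ennreal (tail_power i y)"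
        "ennreal (lam ^ Suc i * tail_power i y) = ennreal (lam ^ Suc i) * ennreal (tail_power i y)" for i
        using tail_bounds lam_pos tail_power_nonneg[of y i] by (auto simp: ennreal_mult)
      with True show ?thesis
        unfolding renewal_def by (simp only: indicator_simps mult_1_right flip: ennreal_suminf_cmult)
           (simp add: ac_simps)
    qed simp
  qed
  also have "\<dots> = (\<Sum>i. ennreal (lam ^ Suc i) * ennreal (trunc_conv i x))"
  proof (subst nn_integral_suminf)
    show "(\<lambda>y. ennreal (lam ^ Suc i) * (ennreal (tail G (x - y) * tail_power i y) * indicator {0..min x 1} y))
        \<in> borel_measurable lborel" for i
      by measurable
    show "(\<Sum>i. \<integral>\<^sup>+y. ennreal (lam ^ Suc i) * (ennreal (tail G (x - y) * tail_power i y) * indicator {0..min x 1} y) \<partial>lborel)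
       = (\<Sum>i. ennreal (lam ^ Suc i) * ennreal (trunc_conv i x))"
    proof (intro suminf_cong)
      fix i
      have "ennreal (trunc_conv i x) = (\<integral>\<^sup>+y. ennreal (tail G (x - y) * tail_power i y) * indicator {0..min x 1} y \<partial>lborel)"
        by (rule nn_integral_eq_set_integral_bounded[where B = "1 / fact i"]) (use tail_tail_power_bounds in auto)
      then show "(\<integral>\<^sup>+y. ennreal (lam ^ Suc i) * (ennreal (tail G (x - y) * tail_power i y) * indicator {0..min x 1} y) \<partial>lborel)
        = ennreal (lam ^ Suc i) * ennreal (trunc_conv i x)"
        by (subst nn_integral_cmult) (auto simp del: conv_power.simps)
    qed
  qed
  also have "\<dots> = (\<Sum>i. ennreal (lam ^ Suc i * trunc_conv i x))"
    using lam_pos trunc_conv_bounds[OF assms] by (intro suminf_cong) (simp add: ennreal_mult)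
  also have "\<dots> = ennreal (\<Sum>i. lam ^ Suc i * trunc_conv i x)"
    using lam_pos trunc_conv_bounds[OF assms] by (intro suminf_ennreal2 summable_scaled[where x = 1]) auto
  finally show ?thesis
    unfolding raw_density_def upcross_def using lam_pos tail_bounds trunc_conv_bounds[OF assms] summable_scaled[where x = 1 and g = "\<lambda>i. trunc_conv i x"]
    by (simp add: ennreal_mult ennreal_plus suminf_nonneg distrib_left del: conv_power.simps)
qed

text \<open>One formula for both cases. Below the threshold, split off the first term of the series;
  each later power is \<open>tail G\<close> convolved with the previous one over all of
  \<open>{0..x}\<close>.\<close>

lemma pi_density_eq:
  assumes "0 < x"
  shows "pi_density lam G m x =
    (lam * tail G x + lam * (\<Sum>i. lam ^ Suc i * trunc_conv i x)) / norm_const lam G m"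
proof (cases "x \<le> 1")
  case True
  have "summable (\<lambda>i. lam ^ Suc i * tail_power i x)"
    using tail_power_bounds assms by (intro summable_scaled[where x = x]) auto
  then have "(\<Sum>i. lam ^ Suc i * tail_power i x) = lam * tail G x + (\<Sum>i. lam ^ Suc (Suc i) * tail_power (Suc i) x)"
    by (subst suminf_split_head) auto
  also have "(\<Sum>i. lam ^ Suc (Suc i) * tail_power (Suc i) x) = (\<Sum>i. lam * (lam ^ Suc i * trunc_conv i x))"
    using True by (intro suminf_cong) (simp add: conv_def min_absorb1)
  also have "\<dots> = lam * (\<Sum>i. lam ^ Suc i * trunc_conv i x)"
    using trunc_conv_bounds[OF assms] by (intro suminf_mult summable_scaled[where x = 1]) auto
  finally show ?thesis
    using True by (simp add: pi_density_def)
qed (simp add: pi_density_def min_absorb2)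

lemma mean_nonneg: "0 \<le> expectation (\<lambda>y. y)"
  by (rule integral_nonneg_AE) (use AE_G_pos in auto)

text \<open>Tonelli on the region \<open>0 < x < y\<close>.\<close>

lemma nn_integral_tail:
  "(\<integral>\<^sup>+x. ennreal (tail G x) * indicator {0<..} x \<partial>lborel) = ennreal (expectation (\<lambda>y. y))"
proof -
  interpret pair_sigma_finite lborel G ..
  have "(\<integral>\<^sup>+x. ennreal (tail G x) * indicator {0<..} x \<partial>lborel)
    = (\<integral>\<^sup>+x. (\<integral>\<^sup>+y. (if 0 < x \<and> x < y then 1 else 0) \<partial>G) \<partial>lborel)"
  proof (intro nn_integral_cong)
    fix x :: real
    have "(\<integral>\<^sup>+y. (if 0 < x \<and> x < y then 1 else 0) \<partial>G) = (\<integral>\<^sup>+y. indicator {0<..} x * indicator {x<..} y \<partial>G)"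
      by (intro nn_integral_cong) (auto simp: indicator_def)
    also have "\<dots> = indicator {0<..} x * emeasure G {x<..}"
      by (subst nn_integral_cmult_indicator) (auto simp: sets_G)
    finally show "ennreal (tail G x) * indicator {0<..} x = (\<integral>\<^sup>+y. (if 0 < x \<and> x < y then 1 else 0) \<partial>G)"
      by (simp add: tail_def emeasure_eq_measure mult.commute)
  qed
  also have "\<dots> = (\<integral>\<^sup>+y. (\<integral>\<^sup>+x. (if 0 < x \<and> x < y then 1 else 0) \<partial>lborel) \<partial>G)"
    by (rule Fubini'[symmetric]) measurable
  also have "\<dots> = (\<integral>\<^sup>+y. ennreal y \<partial>G)"
  proof (intro nn_integral_cong_AE, use AE_G_pos in eventually_elim)
    fix y :: real assume "y > 0"
    have "(\<integral>\<^sup>+x. (if 0 < x \<and> x < y then 1 else 0) \<partial>lborel) = (\<integral>\<^sup>+x. indicator {0<..<y} x \<partial>lborel)"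
      by (intro nn_integral_cong) (auto simp: indicator_def)
    then show "(\<integral>\<^sup>+x. (if 0 < x \<and> x < y then 1 else 0) \<partial>lborel) = ennreal y"
      using \<open>y > 0\<close> by simp
  qed
  also have "\<dots> = ennreal (expectation (\<lambda>y. y))"
    using AE_G_pos by (intro nn_integral_eq_integral integrable_G) auto
  finally show ?thesis .
qed

lemma nn_integral_renewal:
  shows "(\<integral>\<^sup>+y. renewal y * indicator {0..1} y \<partial>lborel) = ennreal (\<Sum>i. lam ^ Suc i * (LBINT y:{0..1}. tail_power i y))"
    and suminf_tail_power_integral_nonneg: "0 \<le> (\<Sum>i. lam ^ Suc i * (LBINT y:{0..1}. tail_power i y))"
proof -
  let ?I = "\<lambda>i. (LBINT y:{0..1}. tail_power i y)"
  have bnd: "0 \<le> tail_power i y \<and> tail_power i y \<le> 1 / fact i" if "y \<in> {0..1}" for i y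
    using that tail_power_nonneg tail_power_le_inverse_fact by auto
  have I: "0 \<le> ?I i" "?I i \<le> 1 ^ i / fact i" for i
    using set_integral_le_bound[where f = "tail_power i" and c = 1 and B = "1 / fact i"] bnd[of _ i]
    by (auto simp del: conv_power.simps)
  have sm: "summable (\<lambda>i. lam ^ Suc i * ?I i)"
    using I by (rule summable_scaled)
  then show "0 \<le> (\<Sum>i. lam ^ Suc i * ?I i)"
    using I lam_pos by (intro suminf_nonneg) auto
  have "(\<integral>\<^sup>+y. renewal y * indicator {0..1} y \<partial>lborel)
      = (\<integral>\<^sup>+y. (\<Sum>i. ennreal (lam ^ Suc i) * (ennreal (tail_power i y) * indicator {0..1} y)) \<partial>lborel)"
    unfolding renewal_def using lam_pos tail_power_nonneg
    by (intro nn_integral_cong) (auto simp: indicator_def ennreal_mult simp del: conv_power.simps)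
  also have "\<dots> = (\<Sum>i. \<integral>\<^sup>+y. ennreal (lam ^ Suc i) * (ennreal (tail_power i y) * indicator {0..1} y) \<partial>lborel)"
    by (rule nn_integral_suminf) measurable
  also have "\<dots> = (\<Sum>i. ennreal (lam ^ Suc i * ?I i))"
  proof (intro suminf_cong)
    fix i
    have "ennreal (?I i) = (\<integral>\<^sup>+y. ennreal (tail_power i y) * indicator {0..1} y \<partial>lborel)"
      by (rule nn_integral_eq_set_integral_bounded[OF tail_power_measurable bnd])
    then show "(\<integral>\<^sup>+y. ennreal (lam ^ Suc i) * (ennreal (tail_power i y) * indicator {0..1} y) \<partial>lborel) = ennreal (lam ^ Suc i * ?I i)"
      using lam_pos I(1)[of i] by (subst nn_integral_cmult) (auto simp: ennreal_mult simp del: conv_power.simps)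
  qed
  also have "\<dots> = ennreal (\<Sum>i. lam ^ Suc i * ?I i)"
    using lam_pos I sm by (intro suminf_ennreal2) auto
  finally show "(\<integral>\<^sup>+y. renewal y * indicator {0..1} y \<partial>lborel) = ennreal (\<Sum>i. lam ^ Suc i * ?I i)" .
qed

lemma C_ge_1: "1 \<le> C"
  using suminf_tail_power_integral_nonneg lam_pos mean_nonneg by (simp add: norm_const_def)

text \<open>After Tonelli, the atom and each \<open>y\<close> in \<open>{0..1}\<close> contribute a
  shifted copy of the tail, whose integral is the mean service time. The total \<open>C - 1\<close>,
  added to an atom of unnormalised mass 1, explains \<open>C\<close> as the normalising
  constant.\<close>

lemma nn_integral_raw_density: "(\<integral>\<^sup>+x. raw_density x * indicator {0<..} x \<partial>lborel) = ennreal (C - 1)"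
proof -
  let ?m = "expectation (\<lambda>y. y)"
  have shift: "(\<integral>\<^sup>+x. ennreal (tail G (x - y)) * indicator {y<..} x \<partial>lborel) = ennreal ?m" for y
    by (subst nn_integral_real_affine[where c = 1 and t = y])
       (auto simp: nn_integral_tail[symmetric] indicator_def intro!: nn_integral_cong)
  have "(\<integral>\<^sup>+x. (\<integral>\<^sup>+y. ennreal (tail G (x - y)) * renewal y * indicator {0..min x 1} y \<partial>lborel) * indicator {0<..} x \<partial>lborel)
    = (\<integral>\<^sup>+x. (\<integral>\<^sup>+y. ennreal (tail G (x - y)) * renewal y * (if 0 \<le> y \<and> y \<le> 1 \<and> y \<le> x \<and> 0 < x then 1 else 0) \<partial>lborel) \<partial>lborel)"
    by (subst nn_integral_multc[symmetric]) (auto intro!: nn_integral_cong simp: indicator_def)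
  also have "\<dots> = (\<integral>\<^sup>+y. (\<integral>\<^sup>+x. ennreal (tail G (x - y)) * renewal y * (if 0 \<le> y \<and> y \<le> 1 \<and> y \<le> x \<and> 0 < x then 1 else 0) \<partial>lborel) \<partial>lborel)"
    by (rule lborel_pair.Fubini') measurable
  also have "\<dots> = (\<integral>\<^sup>+y. (\<integral>\<^sup>+x. renewal y * indicator {0..1} y * (ennreal (tail G (x - y)) * indicator {y<..} x) \<partial>lborel) \<partial>lborel)"
  proof (rule nn_integral_cong, rule nn_integral_cong_AE)
    fix y
    show "AE x in lborel. ennreal (tail G (x - y)) * renewal y * (if 0 \<le> y \<and> y \<le> 1 \<and> y \<le> x \<and> 0 < x then 1 else 0)
      = renewal y * indicator {0..1} y * (ennreal (tail G (x - y)) * indicator {y<..} x)"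
      using AE_lborel_singleton[of y] by eventually_elim (auto simp: indicator_def mult.commute)
  qed
  also have "\<dots> = (\<integral>\<^sup>+y. renewal y * indicator {0..1} y * ennreal ?m \<partial>lborel)"
    by (subst nn_integral_cmult) (simp_all add: shift)
  also have "\<dots> = (\<integral>\<^sup>+y. renewal y * indicator {0..1} y \<partial>lborel) * ennreal ?m"
    by (rule nn_integral_multc) measurable
  finally have "(\<integral>\<^sup>+x. raw_density x * indicator {0<..} x \<partial>lborel)
    = ennreal lam * (ennreal ?m + (\<integral>\<^sup>+y. renewal y * indicator {0..1} y \<partial>lborel) * ennreal ?m)"
    unfolding raw_density_def upcross_def
    by (subst mult.assoc, subst nn_integral_cmult, measurable, subst distrib_right, subst nn_integral_add)
       (measurable, simp add: nn_integral_tail)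
  also have "\<dots> = ennreal (C - 1)"
    unfolding nn_integral_renewal norm_const_def
    using lam_pos mean_nonneg suminf_tail_power_integral_nonneg
    by (simp add: ennreal_mult[symmetric] ennreal_plus[symmetric] algebra_simps del: conv_power.simps ennreal_plus)
  finally show ?thesis .
qed

text \<open>The renewal equation on \<open>(0, 1]\<close>, read off by comparing the two forms of
  \<open>pi_density\<close> over the common nonzero denominator \<open>C\<close>.\<close>

lemma raw_density_eq_renewal:
  assumes "0 < x" "x \<le> 1"
  shows "raw_density x = renewal x"
proof -
  have "(\<Sum>i. lam ^ Suc i * tail_power i x) / C = (lam * tail G x + lam * (\<Sum>i. lam ^ Suc i * trunc_conv i x)) / C"
    using pi_density_eq[OF assms(1)] assms(2) by (simp add: pi_density_def del: conv_power.simps)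
  then show ?thesis
    using C_ge_1 assms by (simp add: raw_density_eq renewal_eq del: conv_power.simps)
qed

section \<open>The candidate stationary law\<close>

abbreviation inv_C :: ennreal where
  "inv_C \<equiv> ennreal (1 / C)"

lemma inv_C_C: "inv_C * ennreal C = 1"
  using C_ge_1 by (simp add: ennreal_mult[symmetric])

lemma pi_density_eq_raw_density:
  assumes "0 < x"
  shows "0 \<le> pi_density lam G (expectation (\<lambda>y. y)) x"
    and "ennreal (pi_density lam G (expectation (\<lambda>y. y)) x) = inv_C * raw_density x"
proof -
  have "0 \<le> (\<Sum>i. lam ^ Suc i * trunc_conv i x)"
    using lam_pos trunc_conv_bounds[OF assms] by (intro suminf_nonneg summable_scaled[where x = 1]) auto
  then have *: "0 \<le> lam * tail G x + lam * (\<Sum>i. lam ^ Suc i * trunc_conv i x)"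
    using lam_pos tail_bounds by (intro add_nonneg_nonneg mult_nonneg_nonneg) auto
  then show "0 \<le> pi_density lam G (expectation (\<lambda>y. y)) x"
    using C_ge_1 by (simp add: pi_density_eq[OF assms] del: conv_power.simps)
  show "ennreal (pi_density lam G (expectation (\<lambda>y. y)) x) = inv_C * raw_density x"
    using C_ge_1 * by (simp add: pi_density_eq[OF assms] raw_density_eq[OF assms] ennreal_mult[symmetric] del: conv_power.simps)
qed

text \<open>The interval \<open>{-1..0}\<close>, which \<open>\<lambda>x. max x 0\<close> collapses to 0, carries the atom.\<close>

definition lifted_density :: "real \<Rightarrow> ennreal" where
  "lifted_density x = inv_C * (indicator {-1..0} x + raw_density x * indicator {0<..} x)"

definition stat :: "real measure" where
  "stat = distr (density lborel lifted_density) borel (\<lambda>x. max x 0)"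

lemma lifted_density_measurable [measurable]: "lifted_density \<in> borel_measurable borel"
  unfolding lifted_density_def by measurable

lemma sets_stat [measurable_cong]: "sets stat = sets borel"
  by (simp add: stat_def)

lemma nn_integral_stat:
  assumes [measurable]: "f \<in> borel_measurable borel"
  shows "(\<integral>\<^sup>+x. f x \<partial>stat) = inv_C * (f 0 + (\<integral>\<^sup>+x. f x * raw_density x * indicator {0<..} x \<partial>lborel))"
proof -
  have "(\<integral>\<^sup>+x. f x \<partial>stat) = (\<integral>\<^sup>+x. lifted_density x * f (max x 0) \<partial>lborel)"
    unfolding stat_def by (subst nn_integral_distr) (simp_all add: nn_integral_density)
  also have "\<dots> = (\<integral>\<^sup>+x. inv_C * (f 0 * indicator {-1..0} x + f x * raw_density x * indicator {0<..} x) \<partial>lborel)"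
    by (intro nn_integral_cong) (auto simp: lifted_density_def indicator_def max_def ac_simps)
  also have "\<dots> = inv_C * (f 0 + (\<integral>\<^sup>+x. f x * raw_density x * indicator {0<..} x \<partial>lborel))"
    by (simp add: nn_integral_cmult nn_integral_add)
  finally show ?thesis .
qed

lemma prob_space_stat: "prob_space stat"
proof
  have "emeasure stat (space stat) = (\<integral>\<^sup>+x. 1 \<partial>stat)"
    by simp
  also have "\<dots> = inv_C * (1 + ennreal (C - 1))"
    by (subst nn_integral_stat) (simp_all add: nn_integral_raw_density)
  also have "1 + ennreal (C - 1) = ennreal C"
    using C_ge_1 by (simp add: ennreal_1[symmetric] ennreal_plus[symmetric] del: ennreal_1 ennreal_plus)
  finally show "emeasure stat (space stat) = 1"
    by (simp add: inv_C_C)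
qed

sublocale stat: prob_space stat
  by (rule prob_space_stat)

lemma stat_negative: "emeasure stat {..<0} = 0"
proof -
  have "(\<lambda>x :: real. max x 0) -` {..<0} = {}" by auto
  then show ?thesis unfolding stat_def by (subst emeasure_distr) auto
qed

lemma stat_tail:
  assumes "0 \<le> b"
  shows "emeasure stat {b<..} = inv_C * (\<integral>\<^sup>+x. raw_density x * indicator {b<..} x \<partial>lborel)"
proof -
  have "emeasure stat {b<..} = (\<integral>\<^sup>+x. indicator {b<..} x \<partial>stat)"
    by (simp add: sets_stat)
  also have "\<dots> = inv_C * (\<integral>\<^sup>+x. indicator {b<..} x * raw_density x * indicator {0<..} x \<partial>lborel)"
    using assms by (subst nn_integral_stat) auto
  also have "(\<integral>\<^sup>+x. indicator {b<..} x * raw_density x * indicator {0<..} x \<partial>lborel) = (\<integral>\<^sup>+x. raw_density x * indicator {b<..} x \<partial>lborel)"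
    using assms by (intro nn_integral_cong) (auto simp: indicator_def)
  finally show ?thesis .
qed

lemma stat_density:
  assumes B: "B \<in> sets borel" "B \<subseteq> {0<..}"
  shows "emeasure stat B = (\<integral>\<^sup>+x\<in>B. ennreal (pi_density lam G (expectation (\<lambda>y. y)) x) \<partial>lborel)"
proof -
  have [measurable]: "B \<in> sets borel" by fact
  have "emeasure stat B = (\<integral>\<^sup>+x. indicator B x \<partial>stat)"
    by (simp add: sets_stat)
  also have "\<dots> = (\<integral>\<^sup>+x. inv_C * (indicator B x * raw_density x * indicator {0<..} x) \<partial>lborel)"
  proof -
    have "0 \<notin> B" using B(2) by auto
    then show ?thesis by (subst nn_integral_stat) (auto simp: nn_integral_cmult)
  qed
  also have "\<dots> = (\<integral>\<^sup>+x\<in>B. ennreal (pi_density lam G (expectation (\<lambda>y. y)) x) \<partial>lborel)"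
    using B(2) by (intro nn_integral_cong) (auto simp: indicator_def pi_density_eq_raw_density)
  finally show ?thesis .
qed

lemma has_density_on_stat:
  "has_density_on stat (pi_density lam G (expectation (\<lambda>y. y))) {0<..}"
  unfolding has_density_on_def
proof (intro conjI ballI allI impI)
  \<comment> \<open>The identification of \<open>pi_density\<close> is available only at positive
    arguments, so measurability is transferred from \<open>raw_density\<close>, which agrees with it
    there up to the factor \<open>1 / C\<close>.\<close>
  have "(\<lambda>x. enn2real (inv_C * raw_density x)) \<in> borel_measurable (restrict_space borel {0<..})"
    by (intro measurable_restrict_space1) measurable
  also have "?this \<longleftrightarrow> pi_density lam G (expectation (\<lambda>y. y)) \<in> borel_measurable (restrict_space borel {0<..})"
  proof (rule measurable_cong)
    fix x :: real assume "x \<in> space (restrict_space borel {0<..})"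
    then have "0 < x" by simp
    then show "enn2real (inv_C * raw_density x) = pi_density lam G (expectation (\<lambda>y. y)) x"
      using pi_density_eq_raw_density[of x] by (simp flip: pi_density_eq_raw_density(2))
  qed
  finally show "pi_density lam G (expectation (\<lambda>y. y)) \<in> borel_measurable (restrict_space borel {0<..})" .
qed (auto simp: pi_density_eq_raw_density stat_density)

section \<open>Jumps from the stationary state\<close>

text \<open>The workload just after an arrival that finds workload \<open>v\<close> and brings
  service time \<open>y\<close>.\<close>

definition jump :: "real \<Rightarrow> real \<Rightarrow> real" where
  "jump v y = v + (if v < 1 then y else 0)"

lemma jump_measurable [measurable (raw)]:
  assumes [measurable]: "f \<in> borel_measurable M" "g \<in> borel_measurable M"
  shows "(\<lambda>x. jump (f x) (g x)) \<in> borel_measurable M"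
  unfolding jump_def by measurable

text \<open>Jumps only go up, so a state above \<open>b\<close> stays there; a state
  \<open>v\<close> up to \<open>b\<close> crosses \<open>b\<close> with probability
  \<open>tail G (b - v)\<close>, provided \<open>v < 1\<close>. Summing the crossings over the atom
  and the density gives \<open>upcross b\<close>.\<close>

lemma stat_jump_tail:
  assumes "0 < b"
  shows "(\<integral>\<^sup>+v. \<integral>\<^sup>+y. indicator {b<..} (jump v y) \<partial>G \<partial>stat) = emeasure stat {b<..} + inv_C * upcross b"
proof -
  have *: "(\<integral>\<^sup>+y. indicator {b<..} (jump v y) \<partial>G)
    = (if v < 1 then ennreal (tail G (b - v)) else indicator {b<..} v)" for v
  proof (cases "v < 1")
    case True
    then have "(\<integral>\<^sup>+y. indicator {b<..} (jump v y) \<partial>G) = (\<integral>\<^sup>+y. indicator {b - v<..} y \<partial>G)"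
      by (intro nn_integral_cong) (auto simp: indicator_def jump_def)
    with True show ?thesis
      by (simp add: sets_G tail_def emeasure_eq_measure)
  qed (simp add: jump_def emeasure_space_1[simplified])
  have "(\<integral>\<^sup>+v. \<integral>\<^sup>+y. indicator {b<..} (jump v y) \<partial>G \<partial>stat)
    = inv_C * (ennreal (tail G b) + (\<integral>\<^sup>+v. (if v < 1 then ennreal (tail G (b - v)) else indicator {b<..} v) * raw_density v * indicator {0<..} v \<partial>lborel))"
    unfolding * by (subst nn_integral_stat) auto
  also have "(\<integral>\<^sup>+v. (if v < 1 then ennreal (tail G (b - v)) else indicator {b<..} v) * raw_density v * indicator {0<..} v \<partial>lborel)
    = (\<integral>\<^sup>+v. raw_density v * indicator {b<..} v + ennreal (tail G (b - v)) * renewal v * indicator {0..min b 1} v \<partial>lborel)"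
  proof (intro nn_integral_cong_AE)
    show "AE v in lborel. (if v < 1 then ennreal (tail G (b - v)) else indicator {b<..} v) * raw_density v * indicator {0<..} v
      = raw_density v * indicator {b<..} v + ennreal (tail G (b - v)) * renewal v * indicator {0..min b 1} v"
      \<comment> \<open>For \<open>v\<close> in \<open>(b, 1)\<close> the tail is taken at a
        negative argument and equals 1. The formulas may disagree at 0, at the threshold and at
        \<open>b\<close>, which are null.\<close>
      using AE_lborel_singleton[of 0] AE_lborel_singleton[of 1] AE_lborel_singleton[of b]
      by eventually_elim (use assms in \<open>auto simp: indicator_def raw_density_eq_renewal tail_nonpos\<close>)
  qed
  also have "\<dots> = (\<integral>\<^sup>+v. raw_density v * indicator {b<..} v \<partial>lborel)
      + (\<integral>\<^sup>+v. ennreal (tail G (b - v)) * renewal v * indicator {0..min b 1} v \<partial>lborel)"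
    by (rule nn_integral_add) auto
  finally show ?thesis
    using assms by (simp add: stat_tail upcross_def distrib_left ac_simps)
qed

section \<open>The exponential law and the decomposition at the last arrival\<close>

definition exp_law :: "real measure" where
  "exp_law = density lborel (exponential_density lam)"

lemma sets_exp_law [measurable_cong]: "sets exp_law = sets borel"
  by (simp add: exp_law_def)

lemma space_exp_law [simp]: "space exp_law = UNIV"
  by (simp add: exp_law_def)

sublocale exp_law: prob_space exp_law
  unfolding exp_law_def by (rule prob_space_exponential_density[OF lam_pos])

lemma nn_integral_exp_law:
  assumes [measurable]: "f \<in> borel_measurable borel"
  shows "(\<integral>\<^sup>+e. f e \<partial>exp_law) = (\<integral>\<^sup>+e. ennreal (lam * exp (- lam * e)) * f e * indicator {0..} e \<partial>lborel)"
  unfolding exp_law_def using lam_pos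
  by (subst nn_integral_density)
     (auto simp: exponential_density_def indicator_def mult.commute intro!: nn_integral_cong)

lemma AE_exp_law_pos: "AE e in exp_law. 0 < e"
  unfolding exp_law_def using AE_lborel_singleton[of "0 :: real"]
  by (subst AE_density) (auto simp: exponential_density_def elim!: eventually_mono)

lemma exp_law_tail:
  assumes "0 \<le> t"
  shows "emeasure exp_law {t<..} = ennreal (exp (- lam * t))" "emeasure exp_law {..t} = ennreal (1 - exp (- lam * t))"
proof -
  have D: "distributed exp_law lborel (\<lambda>x. x) (exponential_density lam)"
    unfolding distributed_def using lam_pos
    by (auto simp: exp_law_def distr_id2)
  show "emeasure exp_law {t<..} = ennreal (exp (- lam * t))"
    using exp_law.exponential_distributedD_gt[OF D assms lam_pos]
    by (simp add: exp_law.emeasure_eq_measure greaterThan_def mult.commute)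
  show "emeasure exp_law {..t} = ennreal (1 - exp (- lam * t))"
    using exp_law.exponential_distributedD_le[OF D assms lam_pos]
    by (simp add: exp_law.emeasure_eq_measure atMost_def mult.commute)
qed

text \<open>
  Here \<open>e\<close> is the age at time \<open>t\<close> of the last arrival; \<open>t < e\<close> means that there was none in \<open>(0, t]\<close>.
\<close>

lemma stat_last_arrival:
  assumes t: "0 \<le> t" and [measurable]: "f \<in> borel_measurable borel"
  shows "(\<integral>\<^sup>+v. f v \<partial>stat) =
    (\<integral>\<^sup>+e. \<integral>\<^sup>+v. \<integral>\<^sup>+y. f (if t < e then max (v - t) 0 else max (jump v y - e) 0) \<partial>G \<partial>stat \<partial>exp_law)"
proof -
  let ?phi = "\<lambda>e v y. if t < e then max (v - t) 0 else max (jump v y - e) 0"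
  interpret ES: pair_prob_space exp_law stat ..
  interpret ESG: pair_prob_space "exp_law \<Otimes>\<^sub>M stat" G ..
  \<comment> \<open>\<open>N\<close> is the law described by the right-hand side; it is compared
    with \<open>stat\<close> on the half-lines \<open>{a<..}\<close>.\<close>
  define N where "N = distr ((exp_law \<Otimes>\<^sub>M stat) \<Otimes>\<^sub>M G) borel (\<lambda>x. ?phi (fst (fst x)) (snd (fst x)) (snd x))"
  have phi [measurable]: "(\<lambda>x. ?phi (fst (fst x)) (snd (fst x)) (snd x)) \<in> borel_measurable ((exp_law \<Otimes>\<^sub>M stat) \<Otimes>\<^sub>M G)"
    by measurable
  have N: "(\<integral>\<^sup>+v. g v \<partial>N) = (\<integral>\<^sup>+e. \<integral>\<^sup>+v. \<integral>\<^sup>+y. g (?phi e v y) \<partial>G \<partial>stat \<partial>exp_law)"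
    if [measurable]: "g \<in> borel_measurable borel" for g :: "real \<Rightarrow> ennreal"
  proof -
    have "(\<integral>\<^sup>+v. g v \<partial>N) = (\<integral>\<^sup>+x. g (?phi (fst (fst x)) (snd (fst x)) (snd x)) \<partial>((exp_law \<Otimes>\<^sub>M stat) \<Otimes>\<^sub>M G))"
      unfolding N_def by (subst nn_integral_distr) auto
    also have "\<dots> = (\<integral>\<^sup>+x. \<integral>\<^sup>+y. g (?phi (fst x) (snd x) y) \<partial>G \<partial>(exp_law \<Otimes>\<^sub>M stat))"
      by (subst nn_integral_fst[symmetric]) (auto simp: case_prod_beta cong: if_cong)
    also have "\<dots> = (\<integral>\<^sup>+e. \<integral>\<^sup>+v. \<integral>\<^sup>+y. g (?phi e v y) \<partial>G \<partial>stat \<partial>exp_law)"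
      by (subst stat.nn_integral_fst[symmetric]) (auto simp: case_prod_beta cong: if_cong)
    finally show ?thesis .
  qed
  have "stat = N"
  proof (rule measure_eqI_lessThan)
    show "sets stat = sets borel" "sets N = sets borel"
      by (simp_all add: sets_stat N_def)
    show "emeasure stat {a<..} < \<infinity>" for a
      by (simp add: stat.emeasure_eq_measure)
    fix a :: real
    let ?F = "\<lambda>b. emeasure stat {b<..}"
    have Na: "emeasure N {a<..} = (\<integral>\<^sup>+e. \<integral>\<^sup>+v. \<integral>\<^sup>+y. indicator {a<..} (?phi e v y) \<partial>G \<partial>stat \<partial>exp_law)"
      by (subst N[symmetric]) (auto simp: N_def)
    show "emeasure stat {a<..} = emeasure N {a<..}"
    proof (cases "a < 0")
      case True
      then have 1: "indicator {a<..} (?phi e v y) = (1 :: ennreal)" for e v y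
        by (auto simp: indicator_def)
      have "emeasure N {a<..} = 1"
        unfolding Na 1 by (simp add: emeasure_space_1[simplified] stat.emeasure_space_1 exp_law.emeasure_space_1[simplified])
      moreover have "?F a = 1"
      proof -
        have "AE x in stat. x \<in> {a<..}"
          by (rule AE_I[OF _ stat_negative]) (use True in \<open>auto simp: sets_stat\<close>)
        then show ?thesis
          by (intro stat.emeasure_eq_1_AE) (auto simp: sets_stat)
      qed
      ultimately show ?thesis by simp
    next
      case False
      then have a: "0 \<le> a" by simp
      \<comment> \<open>The stationary density at height \<open>a + u\<close>, from which the unit
        drift reaches level \<open>a\<close> after time \<open>u\<close>. Integrated over
        \<open>{s<..t}\<close> it gives the stationary mass between \<open>a + s\<close> and
        \<open>a + t\<close>.\<close>
      let ?p = "\<lambda>u. inv_C * raw_density (a + u)"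
      have shift: "inv_C * (\<integral>\<^sup>+x. raw_density x * indicator {a + s<..a + t} x \<partial>lborel) = (\<integral>\<^sup>+u. ?p u * indicator {s<..t} u \<partial>lborel)" for s
        by (subst nn_integral_real_affine[where c = 1 and t = a])
           (auto simp: indicator_def mult.assoc simp flip: nn_integral_cmult intro!: nn_integral_cong)
      have F: "?F (a + s) = ?F (a + t) + (\<integral>\<^sup>+u. ?p u * indicator {s<..t} u \<partial>lborel)" if "0 \<le> s" "s \<le> t" for s
      proof -
        have "(\<integral>\<^sup>+x. raw_density x * indicator {a + s<..} x \<partial>lborel)
          = (\<integral>\<^sup>+x. raw_density x * indicator {a + t<..} x + raw_density x * indicator {a + s<..a + t} x \<partial>lborel)"
          using that by (intro nn_integral_cong) (auto simp: indicator_def)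
        also have "\<dots> = (\<integral>\<^sup>+x. raw_density x * indicator {a + t<..} x \<partial>lborel) + (\<integral>\<^sup>+x. raw_density x * indicator {a + s<..a + t} x \<partial>lborel)"
          by (rule nn_integral_add) auto
        finally show ?thesis
          using a that t by (simp add: stat_tail shift[symmetric] distrib_left)
      qed
      \<comment> \<open>One formula for all ages \<open>e\<close>: the mass above
        \<open>a + t\<close> survives the drift in any case; if the last arrival is within the
        window, there is also the mass between \<open>a + e\<close> and \<open>a + t\<close>, and
        the mass lifted over \<open>a + e\<close> by the jump. For \<open>t < e\<close> the last two
        terms vanish.\<close>
      have "emeasure N {a<..} = (\<integral>\<^sup>+e. ?F (a + t) + ((\<integral>\<^sup>+u. ?p u * (if e \<le> u \<and> 0 < u \<and> u \<le> t then 1 else 0) \<partial>lborel)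
          + inv_C * upcross (a + e) * indicator {..t} e) \<partial>exp_law)"
        unfolding Na
      proof (intro nn_integral_cong_AE, use AE_exp_law_pos in eventually_elim)
        fix e :: real assume e: "0 < e"
        show "(\<integral>\<^sup>+v. \<integral>\<^sup>+y. indicator {a<..} (?phi e v y) \<partial>G \<partial>stat) =
          ?F (a + t) + ((\<integral>\<^sup>+u. ?p u * (if e \<le> u \<and> 0 < u \<and> u \<le> t then 1 else 0) \<partial>lborel)
          + inv_C * upcross (a + e) * indicator {..t} e)"
        proof (cases "t < e")
          case True
          have "(\<integral>\<^sup>+v. \<integral>\<^sup>+y. indicator {a<..} (?phi e v y) \<partial>G \<partial>stat) = (\<integral>\<^sup>+v. indicator {a + t<..} v \<partial>stat)"
            using True a by (intro nn_integral_cong) (auto simp: indicator_def emeasure_space_1[simplified])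
          moreover have "(if e \<le> u \<and> 0 < u \<and> u \<le> t then 1 else 0) = (0 :: ennreal)" for u
            using True by auto
          ultimately show ?thesis
            using True by (simp add: sets_stat)
        next
          case False
          have "(\<integral>\<^sup>+v. \<integral>\<^sup>+y. indicator {a<..} (?phi e v y) \<partial>G \<partial>stat) = (\<integral>\<^sup>+v. \<integral>\<^sup>+y. indicator {a + e<..} (jump v y) \<partial>G \<partial>stat)"
            using False a by (intro nn_integral_cong) (auto simp: indicator_def)
          also have "\<dots> = ?F (a + e) + inv_C * upcross (a + e)"
            by (rule stat_jump_tail) (use a e in auto)
          also have "?F (a + e) = ?F (a + t) + (\<integral>\<^sup>+u. ?p u * indicator {e<..t} u \<partial>lborel)"
            by (rule F) (use e False in auto)
          also have "(\<integral>\<^sup>+u. ?p u * indicator {e<..t} u \<partial>lborel)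
            = (\<integral>\<^sup>+u. ?p u * (if e \<le> u \<and> 0 < u \<and> u \<le> t then 1 else 0) \<partial>lborel)"
          proof (intro nn_integral_cong_AE)
            show "AE u in lborel. ?p u * indicator {e<..t} u = ?p u * (if e \<le> u \<and> 0 < u \<and> u \<le> t then 1 else 0)"
              using AE_lborel_singleton[of e] by eventually_elim (use e in \<open>auto simp: indicator_def\<close>)
          qed
          finally show ?thesis
            using False by (simp add: add.assoc)
        qed
      qed
      also have "\<dots> = ?F (a + t) + ((\<integral>\<^sup>+e. \<integral>\<^sup>+u. ?p u * (if e \<le> u \<and> 0 < u \<and> u \<le> t then 1 else 0) \<partial>lborel \<partial>exp_law)
          + (\<integral>\<^sup>+e. inv_C * upcross (a + e) * indicator {..t} e \<partial>exp_law))"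
        by (subst nn_integral_add, measurable, subst nn_integral_add) (auto simp: exp_law.emeasure_space_1[simplified])
      also have "(\<integral>\<^sup>+e. \<integral>\<^sup>+u. ?p u * (if e \<le> u \<and> 0 < u \<and> u \<le> t then 1 else 0) \<partial>lborel \<partial>exp_law)
        = (\<integral>\<^sup>+u. \<integral>\<^sup>+e. ?p u * (if e \<le> u \<and> 0 < u \<and> u \<le> t then 1 else 0) \<partial>exp_law \<partial>lborel)"
      proof -
        interpret pair_sigma_finite lborel exp_law ..
        show ?thesis by (rule Fubini') measurable
      qed
      \<comment> \<open>The age is at most \<open>u\<close> with probability
        \<open>1 - exp (- lam * u)\<close>.\<close>
      also have "\<dots> = (\<integral>\<^sup>+u. ?p u * indicator {0<..t} u * ennreal (1 - exp (- lam * u)) \<partial>lborel)"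
      proof (rule nn_integral_cong)
        fix u
        have "(\<integral>\<^sup>+e. ?p u * (if e \<le> u \<and> 0 < u \<and> u \<le> t then 1 else 0) \<partial>exp_law)
          = (\<integral>\<^sup>+e. (?p u * indicator {0<..t} u) * indicator {..u} e \<partial>exp_law)"
          by (intro nn_integral_cong) (auto simp: indicator_def)
        also have "\<dots> = ?p u * indicator {0<..t} u * emeasure exp_law {..u}"
          by (rule nn_integral_cmult_indicator) (simp add: sets_exp_law)
        finally show "(\<integral>\<^sup>+e. ?p u * (if e \<le> u \<and> 0 < u \<and> u \<le> t then 1 else 0) \<partial>exp_law)
          = ?p u * indicator {0<..t} u * ennreal (1 - exp (- lam * u))"
          by (cases "0 < u") (auto simp: exp_law_tail)
      qed
      \<comment> \<open>The balance of crossings enters here: the factor \<open>lam\<close> of the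
        exponential density turns \<open>upcross\<close> into \<open>raw_density\<close>, so the
        same \<open>?p\<close> appears with the complementary weight \<open>exp (- lam * u)\<close>,
        and the two weights add up to 1.\<close>
      also have "(\<integral>\<^sup>+e. inv_C * upcross (a + e) * indicator {..t} e \<partial>exp_law)
        = (\<integral>\<^sup>+u. ?p u * indicator {0<..t} u * ennreal (exp (- lam * u)) \<partial>lborel)"
      proof (subst nn_integral_exp_law)
        show "(\<integral>\<^sup>+e. ennreal (lam * exp (- lam * e)) * (inv_C * upcross (a + e) * indicator {..t} e) * indicator {0..} e \<partial>lborel)
          = (\<integral>\<^sup>+u. ?p u * indicator {0<..t} u * ennreal (exp (- lam * u)) \<partial>lborel)"
        proof (intro nn_integral_cong_AE)
          show "AE e in lborel. ennreal (lam * exp (- lam * e)) * (inv_C * upcross (a + e) * indicator {..t} e) * indicator {0..} e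
            = ?p e * indicator {0<..t} e * ennreal (exp (- lam * e))"
            using AE_lborel_singleton[of 0]
            by eventually_elim (use lam_pos in \<open>auto simp: indicator_def raw_density_def ennreal_mult ac_simps\<close>)
        qed
      qed measurable
      also have "(\<integral>\<^sup>+u. ?p u * indicator {0<..t} u * ennreal (1 - exp (- lam * u)) \<partial>lborel)
        + (\<integral>\<^sup>+u. ?p u * indicator {0<..t} u * ennreal (exp (- lam * u)) \<partial>lborel)
        = (\<integral>\<^sup>+u. ?p u * indicator {0<..t} u * ennreal (1 - exp (- lam * u)) + ?p u * indicator {0<..t} u * ennreal (exp (- lam * u)) \<partial>lborel)"
        by (rule nn_integral_add[symmetric]) auto
      also have "\<dots> = (\<integral>\<^sup>+u. ?p u * indicator {0<..t} u \<partial>lborel)"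
      proof (rule nn_integral_cong)
        fix u
        show "?p u * indicator {0<..t} u * ennreal (1 - exp (- lam * u)) + ?p u * indicator {0<..t} u * ennreal (exp (- lam * u))
          = ?p u * indicator {0<..t} u"
        proof (cases "0 < u")
          case True
          then have "ennreal (1 - exp (- lam * u)) + ennreal (exp (- lam * u)) = 1"
            using lam_pos by (subst ennreal_plus[symmetric]) auto
          then show ?thesis
            by (simp flip: distrib_left)
        qed simp
      qed
      also have "?F (a + t) + (\<integral>\<^sup>+u. ?p u * indicator {0<..t} u \<partial>lborel) = ?F a"
        using F[of 0] t by simp
      finally show ?thesis ..
    qed
  qed
  then show ?thesis
    using N[of f] by simp
qed

text \<open>The event of no arrival in \<open>(0, t]\<close> is separated out. In the chain below,
  the first term becomes the contribution of the start and the second that of the arrivals.\<close>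

lemma stat_last_arrival_split:
  assumes t: "0 \<le> t" and [measurable]: "f \<in> borel_measurable borel"
  shows "(\<integral>\<^sup>+v. f v \<partial>stat) = ennreal (exp (- lam * t)) * (\<integral>\<^sup>+v. f (max (v - t) 0) \<partial>stat) +
    (\<integral>\<^sup>+e. (\<integral>\<^sup>+v. \<integral>\<^sup>+y. f (max (jump v y - e) 0) \<partial>G \<partial>stat) * indicator {..t} e \<partial>exp_law)"
proof -
  let ?A = "\<integral>\<^sup>+v. f (max (v - t) 0) \<partial>stat" and ?B = "\<lambda>e. \<integral>\<^sup>+v. \<integral>\<^sup>+y. f (max (jump v y - e) 0) \<partial>G \<partial>stat"
  have "(\<integral>\<^sup>+v. f v \<partial>stat) = (\<integral>\<^sup>+e. ?A * indicator {t<..} e + ?B e * indicator {..t} e \<partial>exp_law)"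
    unfolding stat_last_arrival[OF assms]
    by (intro nn_integral_cong) (auto simp: indicator_def emeasure_space_1[simplified])
  also have "\<dots> = (\<integral>\<^sup>+e. ?A * indicator {t<..} e \<partial>exp_law) + (\<integral>\<^sup>+e. ?B e * indicator {..t} e \<partial>exp_law)"
    by (rule nn_integral_add) measurable
  also have "(\<integral>\<^sup>+e. ?A * indicator {t<..} e \<partial>exp_law) = ?A * emeasure exp_law {t<..}"
    by (rule nn_integral_cmult_indicator) (simp add: sets_exp_law)
  finally show ?thesis
    using t by (simp add: exp_law_tail mult.commute)
qed

section \<open>The Markov chain observed at arrivals\<close>

text \<open>A state pairs the workload just after an arrival with its epoch; \<open>e\<close> is the
  time to the next arrival and \<open>y\<close> the service time it brings.\<close>

definition step :: "real \<times> real \<Rightarrow> real \<Rightarrow> real \<Rightarrow> real \<times> real" where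
  "step w e y = (jump (max (fst w - e) 0) y, snd w + e)"

text \<open>The transition operator of the chain, acting on functions.\<close>

definition next_mean :: "(real \<times> real \<Rightarrow> ennreal) \<Rightarrow> real \<times> real \<Rightarrow> ennreal" where
  "next_mean g w = (\<integral>\<^sup>+e. \<integral>\<^sup>+y. g (step w e y) \<partial>G \<partial>exp_law)"

lemma step_measurable [measurable (raw)]:
  assumes [measurable]: "w \<in> M \<rightarrow>\<^sub>M borel \<Otimes>\<^sub>M borel" "e \<in> borel_measurable M" "y \<in> borel_measurable M"
  shows "(\<lambda>x. step (w x) (e x) (y x)) \<in> M \<rightarrow>\<^sub>M borel \<Otimes>\<^sub>M borel"
  unfolding step_def by measurable

lemma next_mean_measurable [measurable]:
  assumes [measurable]: "g \<in> borel_measurable (borel \<Otimes>\<^sub>M borel)"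
  shows "next_mean g \<in> borel_measurable (borel \<Otimes>\<^sub>M borel)"
  unfolding next_mean_def by measurable

lemma next_mean_funpow_measurable [measurable]:
  "g \<in> borel_measurable (borel \<Otimes>\<^sub>M borel) \<Longrightarrow> (next_mean ^^ n) g \<in> borel_measurable (borel \<Otimes>\<^sub>M borel)"
  by (induction n) auto

definition start_mean :: "(real \<times> real \<Rightarrow> ennreal) \<Rightarrow> ennreal" where
  "start_mean g = (\<integral>\<^sup>+v. g (v, 0) \<partial>stat)"

text \<open>Mean of \<open>g\<close> summed over the arrivals of the stationary process after time 0.\<close>

definition arrival_mean :: "(real \<times> real \<Rightarrow> ennreal) \<Rightarrow> ennreal" where
  "arrival_mean g = (\<integral>\<^sup>+u. ennreal lam * (\<integral>\<^sup>+v. \<integral>\<^sup>+y. g (jump v y, u) \<partial>G \<partial>stat) * indicator {0..} u \<partial>lborel)"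

text \<open>An arrival of the stationary stream at time \<open>u\<close> is either the first after
  time 0, so one step of the chain from the start, or one step after an earlier arrival of the
  stream. The decomposition at the last arrival, applied just before \<open>u\<close>, separates the
  two cases.\<close>

lemma arrival_mean_first_arrival:
  assumes [measurable]: "g \<in> borel_measurable (borel \<Otimes>\<^sub>M borel)"
  shows "start_mean (next_mean g) + arrival_mean (next_mean g) = arrival_mean g"
proof -
  define k where "k u v = (\<integral>\<^sup>+y. g (jump v y, u) \<partial>G)" for u v
  have [measurable]: "(\<lambda>x. k (fst x) (snd x)) \<in> borel_measurable (borel \<Otimes>\<^sub>M borel)"
    unfolding k_def by measurable
  have [measurable]: "(\<lambda>x. k (a x) (b x)) \<in> borel_measurable M"
    if [measurable]: "a \<in> borel_measurable M" "b \<in> borel_measurable M" for a b :: "'b \<Rightarrow> real" and M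
  proof -
    have "(\<lambda>x. k (fst x) (snd x)) \<circ> (\<lambda>x. (a x, b x)) \<in> borel_measurable M"
      by (rule measurable_comp[where N = "borel \<Otimes>\<^sub>M borel"]) measurable
    then show ?thesis by (simp add: comp_def)
  qed
  \<comment> \<open>\<open>k u v\<close> is the mean of \<open>g\<close> after an arrival at
    \<open>u\<close> that finds \<open>v\<close>. In \<open>A u\<close> the state found has drifted
    from time 0 without arrivals; in \<open>B e u\<close> the previous arrival was at
    \<open>u - e\<close>.\<close>
  define A where "A u = (\<integral>\<^sup>+v. k u (max (v - u) 0) \<partial>stat)" for u
  define B where "B e u = (\<integral>\<^sup>+v. \<integral>\<^sup>+y. k u (max (jump v y - e) 0) \<partial>G \<partial>stat)" for e u
  have [measurable]: "A \<in> borel_measurable borel"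
    unfolding A_def by measurable
  have B_pair [measurable]: "(\<lambda>x. B (fst x) (snd x)) \<in> borel_measurable (borel \<Otimes>\<^sub>M borel)"
    unfolding B_def by measurable
  have [measurable]: "(\<lambda>x. B (a x) (b x)) \<in> borel_measurable M"
    if [measurable]: "a \<in> borel_measurable M" "b \<in> borel_measurable M" for a b :: "'b \<Rightarrow> real" and M
  proof -
    have "(\<lambda>x. B (fst x) (snd x)) \<circ> (\<lambda>x. (a x, b x)) \<in> borel_measurable M"
      by (rule measurable_comp[where N = "borel \<Otimes>\<^sub>M borel"]) measurable
    then show ?thesis by (simp add: comp_def)
  qed
  have next_mean: "next_mean g (v, s) = (\<integral>\<^sup>+e. k (s + e) (max (v - e) 0) \<partial>exp_law)" for v s
    by (simp add: next_mean_def step_def k_def)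
  have "arrival_mean g = (\<integral>\<^sup>+u. ennreal (lam * exp (- lam * u)) * A u * indicator {0..} u
    + ennreal lam * ((\<integral>\<^sup>+e. B e u * indicator {..u} e \<partial>exp_law) * indicator {0..} u) \<partial>lborel)"
    unfolding arrival_mean_def
  proof (intro nn_integral_cong)
    fix u :: real
    show "ennreal lam * (\<integral>\<^sup>+v. \<integral>\<^sup>+y. g (jump v y, u) \<partial>G \<partial>stat) * indicator {0..} u
      = ennreal (lam * exp (- lam * u)) * A u * indicator {0..} u
      + ennreal lam * ((\<integral>\<^sup>+e. B e u * indicator {..u} e \<partial>exp_law) * indicator {0..} u)"
    proof (cases "0 \<le> u")
      case True
      have "(\<integral>\<^sup>+v. \<integral>\<^sup>+y. g (jump v y, u) \<partial>G \<partial>stat) = ennreal (exp (- lam * u)) * A u + (\<integral>\<^sup>+e. B e u * indicator {..u} e \<partial>exp_law)"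
        unfolding k_def[symmetric] A_def B_def
        by (rule stat_last_arrival_split[OF True]) measurable
      with True show ?thesis
        using lam_pos by (simp add: distrib_left ennreal_mult mult.assoc)
    qed simp
  qed
  also have "\<dots> = (\<integral>\<^sup>+u. ennreal (lam * exp (- lam * u)) * A u * indicator {0..} u \<partial>lborel)
    + ennreal lam * (\<integral>\<^sup>+u. (\<integral>\<^sup>+e. B e u * indicator {..u} e \<partial>exp_law) * indicator {0..} u \<partial>lborel)"
  proof -
    have [measurable]: "(\<lambda>u. \<integral>\<^sup>+e. B e u * indicator {..u} e \<partial>exp_law) \<in> borel_measurable borel"
    proof -
      have "(\<lambda>u. \<integral>\<^sup>+e. B e u * (if e \<le> u then 1 else 0) \<partial>exp_law) \<in> borel_measurable borel"
        by measurable
      then show ?thesis by (simp add: indicator_def of_bool_def)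
    qed
    show ?thesis by (subst nn_integral_add) (auto simp: nn_integral_cmult)
  qed
  also have "(\<integral>\<^sup>+u. ennreal (lam * exp (- lam * u)) * A u * indicator {0..} u \<partial>lborel) = start_mean (next_mean g)"
  proof -
    interpret pair_sigma_finite exp_law stat ..
    have "start_mean (next_mean g) = (\<integral>\<^sup>+v. \<integral>\<^sup>+e. k e (max (v - e) 0) \<partial>exp_law \<partial>stat)"
      by (simp add: start_mean_def next_mean)
    also have "\<dots> = (\<integral>\<^sup>+e. A e \<partial>exp_law)"
      unfolding A_def by (rule Fubini') measurable
    finally show ?thesis
      by (simp add: nn_integral_exp_law)
  qed
  also have "ennreal lam * (\<integral>\<^sup>+u. (\<integral>\<^sup>+e. B e u * indicator {..u} e \<partial>exp_law) * indicator {0..} u \<partial>lborel) = arrival_mean (next_mean g)"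
  proof -
    interpret ExG: pair_sigma_finite exp_law G ..
    interpret Exstat: pair_sigma_finite exp_law stat ..
    interpret Exl: pair_sigma_finite exp_law lborel ..
    have inner: "(\<integral>\<^sup>+v. \<integral>\<^sup>+y. next_mean g (jump v y, s) \<partial>G \<partial>stat) = (\<integral>\<^sup>+e. B e (s + e) \<partial>exp_law)" for s
    proof -
      have "(\<integral>\<^sup>+v. \<integral>\<^sup>+y. next_mean g (jump v y, s) \<partial>G \<partial>stat)
        = (\<integral>\<^sup>+v. \<integral>\<^sup>+e. \<integral>\<^sup>+y. k (s + e) (max (jump v y - e) 0) \<partial>G \<partial>exp_law \<partial>stat)"
        unfolding next_mean by (rule nn_integral_cong, rule ExG.Fubini') measurable
      also have "\<dots> = (\<integral>\<^sup>+e. B e (s + e) \<partial>exp_law)"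
        unfolding B_def by (rule Exstat.Fubini') measurable
      finally show ?thesis .
    qed
    have "arrival_mean (next_mean g) = ennreal lam * (\<integral>\<^sup>+s. (\<integral>\<^sup>+e. B e (s + e) * indicator {0..} s \<partial>exp_law) \<partial>lborel)"
      unfolding arrival_mean_def inner by (simp add: nn_integral_cmult nn_integral_multc mult.assoc)
    also have "(\<integral>\<^sup>+s. (\<integral>\<^sup>+e. B e (s + e) * indicator {0..} s \<partial>exp_law) \<partial>lborel)
      = (\<integral>\<^sup>+e. (\<integral>\<^sup>+s. B e (s + e) * indicator {0..} s \<partial>lborel) \<partial>exp_law)"
      by (rule Exl.Fubini') measurable
    \<comment> \<open>Substitute \<open>u = s + e\<close>, the epoch of the next arrival; for
      \<open>e > 0\<close> the condition \<open>0 \<le> s\<close> becomes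
      \<open>e \<le> u\<close>.\<close>
    also have "\<dots> = (\<integral>\<^sup>+e. (\<integral>\<^sup>+u. B e u * (if e \<le> u \<and> 0 \<le> u then 1 else 0) \<partial>lborel) \<partial>exp_law)"
    proof (intro nn_integral_cong_AE, use AE_exp_law_pos in eventually_elim)
      fix e :: real assume "0 < e"
      then show "(\<integral>\<^sup>+s. B e (s + e) * indicator {0..} s \<partial>lborel)
        = (\<integral>\<^sup>+u. B e u * (if e \<le> u \<and> 0 \<le> u then 1 else 0) \<partial>lborel)"
        by (subst (2) nn_integral_real_affine[where c = 1 and t = e])
           (auto simp: indicator_def add.commute intro!: nn_integral_cong)
    qed
    also have "\<dots> = (\<integral>\<^sup>+u. (\<integral>\<^sup>+e. B e u * (if e \<le> u \<and> 0 \<le> u then 1 else 0) \<partial>exp_law) \<partial>lborel)"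
      by (rule Exl.Fubini'[symmetric]) measurable
    also have "\<dots> = (\<integral>\<^sup>+u. (\<integral>\<^sup>+e. B e u * indicator {..u} e \<partial>exp_law) * indicator {0..} u \<partial>lborel)"
      by (auto simp: indicator_def of_bool_def intro!: nn_integral_cong)
    finally show ?thesis ..
  qed
  finally show ?thesis ..
qed

text \<open>Apply the first-arrival identity successively to \<open>g\<close>,
  \<open>next_mean g\<close> and so on; the sum telescopes and the nonnegative remainder is
  dropped.\<close>

lemma sum_next_mean_le_arrival_mean:
  assumes "g \<in> borel_measurable (borel \<Otimes>\<^sub>M borel)"
  shows "(\<Sum>k<n. start_mean ((next_mean ^^ Suc k) g)) \<le> arrival_mean g"
  using assms
proof (induction n arbitrary: g)
  case (Suc n)
  have "(\<Sum>k<Suc n. start_mean ((next_mean ^^ Suc k) g)) = start_mean (next_mean g) + (\<Sum>k<n. start_mean ((next_mean ^^ Suc k) (next_mean g)))"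
    by (subst sum.lessThan_Suc_shift) (simp add: funpow_swap1)
  also have "\<dots> \<le> start_mean (next_mean g) + arrival_mean (next_mean g)"
    using Suc by (intro add_left_mono) auto
  also have "\<dots> = arrival_mean g"
    by (rule arrival_mean_first_arrival) fact
  finally show ?case .
qed simp

text \<open>The stationary stream has intensity \<open>lam\<close>. This finite mean excludes an
  accumulation of epochs later on.\<close>

lemma arrival_mean_counting:
  assumes "0 \<le> t"
  shows "arrival_mean (\<lambda>w. indicator {..t} (snd w)) = ennreal (lam * t)"
proof -
  have "arrival_mean (\<lambda>w. indicator {..t} (snd w)) = (\<integral>\<^sup>+u. ennreal lam * indicator {0..t} u \<partial>lborel)"
    unfolding arrival_mean_def
    by (intro nn_integral_cong) (auto simp: indicator_def emeasure_space_1[simplified] stat.emeasure_space_1)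
  also have "\<dots> = ennreal (lam * t)"
    using assms lam_pos by (simp add: nn_integral_cmult ennreal_mult)
  finally show ?thesis .
qed

text \<open>
  The probability, given the state \<open>w\<close> at an arrival epoch, that this is the last epoch up to time \<open>t\<close>
  and the workload at time \<open>t\<close> is in \<open>A\<close>.
\<close>

definition last_epoch :: "real \<Rightarrow> real set \<Rightarrow> real \<times> real \<Rightarrow> ennreal" where
  "last_epoch t A w = ennreal (exp (- lam * (t - snd w))) * indicator {..t} (snd w) *
     indicator A (max (fst w - (t - snd w)) 0)"

lemma last_epoch_measurable [measurable]:
  assumes [measurable]: "A \<in> sets borel"
  shows "last_epoch t A \<in> borel_measurable (borel \<Otimes>\<^sub>M borel)"
  unfolding last_epoch_def by measurable

text \<open>The last epoch up to \<open>t\<close> is either the start or an arrival of the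
  stationary stream, and the weight \<open>exp (- lam * (t - u))\<close> is the probability of no
  arrival between it and \<open>t\<close>.\<close>

lemma start_mean_add_arrival_mean_last_epoch:
  assumes t: "0 \<le> t" and A [measurable]: "A \<in> sets borel"
  shows "start_mean (last_epoch t A) + arrival_mean (last_epoch t A) = emeasure stat A"
proof -
  let ?B = "\<lambda>e. \<integral>\<^sup>+v. \<integral>\<^sup>+y. indicator A (max (jump v y - e) 0) \<partial>G \<partial>stat :: ennreal"
  have "emeasure stat A = (\<integral>\<^sup>+v. indicator A v \<partial>stat)"
    by (simp add: sets_stat)
  also have "\<dots> = ennreal (exp (- lam * t)) * (\<integral>\<^sup>+v. indicator A (max (v - t) 0) \<partial>stat)
    + (\<integral>\<^sup>+e. ?B e * indicator {..t} e \<partial>exp_law)"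
    by (rule stat_last_arrival_split[OF t]) measurable
  also have "ennreal (exp (- lam * t)) * (\<integral>\<^sup>+v. indicator A (max (v - t) 0) \<partial>stat) = start_mean (last_epoch t A)"
    using t by (simp add: start_mean_def last_epoch_def nn_integral_cmult)
  also have "(\<integral>\<^sup>+e. ?B e * indicator {..t} e \<partial>exp_law) = arrival_mean (last_epoch t A)"
  proof -
    have "(\<integral>\<^sup>+e. ?B e * indicator {..t} e \<partial>exp_law)
      = (\<integral>\<^sup>+e. ennreal (lam * exp (- lam * e)) * (?B e * indicator {..t} e) * indicator {0..} e \<partial>lborel)"
      by (rule nn_integral_exp_law) measurable
    \<comment> \<open>Reflection \<open>u = t - e\<close> passes from the age of the last arrival to
      its epoch.\<close>
    also have "\<dots> = (\<integral>\<^sup>+u. ennreal (lam * exp (- lam * (t - u))) * (?B (t - u) * indicator {..t} (t - u)) * indicator {0..} (t - u) \<partial>lborel)"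
      by (subst nn_integral_real_affine[where c = "-1" and t = t]) (auto intro!: nn_integral_cong)
    also have "\<dots> = arrival_mean (last_epoch t A)"
      unfolding arrival_mean_def
    proof (intro nn_integral_cong)
      fix u :: real
      have "(\<integral>\<^sup>+v. \<integral>\<^sup>+y. last_epoch t A (jump v y, u) \<partial>G \<partial>stat)
        = ennreal (exp (- lam * (t - u))) * indicator {..t} u * ?B (t - u)"
        by (simp add: last_epoch_def nn_integral_cmult)
      then show "ennreal (lam * exp (- lam * (t - u))) * (?B (t - u) * indicator {..t} (t - u)) * indicator {0..} (t - u)
        = ennreal lam * (\<integral>\<^sup>+v. \<integral>\<^sup>+y. last_epoch t A (jump v y, u) \<partial>G \<partial>stat) * indicator {0..} u"
        using lam_pos by (auto simp: indicator_def ennreal_mult ac_simps)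
    qed
    finally show ?thesis .
  qed
  finally show ?thesis ..
qed

text \<open>The term for \<open>n = 0\<close> is the contribution of the start; the others sum to at
  most \<open>arrival_mean\<close>, by telescoping. Together they are bounded by the exact
  decomposition of \<open>stat A\<close>.\<close>

lemma suminf_last_epoch_le_stat:
  assumes "0 \<le> t" and [measurable]: "A \<in> sets borel"
  shows "(\<Sum>n. start_mean ((next_mean ^^ n) (last_epoch t A))) \<le> emeasure stat A"
proof (rule suminf_le_const)
  fix n
  have "(\<Sum>k<n. start_mean ((next_mean ^^ k) (last_epoch t A))) \<le> (\<Sum>k<Suc n. start_mean ((next_mean ^^ k) (last_epoch t A)))"
    by simp
  also have "\<dots> = start_mean (last_epoch t A) + (\<Sum>k<n. start_mean ((next_mean ^^ Suc k) (last_epoch t A)))"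
    by (subst sum.lessThan_Suc_shift) simp
  also have "\<dots> \<le> emeasure stat A"
    unfolding start_mean_add_arrival_mean_last_epoch[OF assms, symmetric] by (intro add_left_mono sum_next_mean_le_arrival_mean) measurable
  finally show "(\<Sum>k<n. start_mean ((next_mean ^^ k) (last_epoch t A))) \<le> emeasure stat A" .
qed simp

end

section \<open>Integration over independent past and future\<close>

lemma (in prob_space) nn_integral_indep_pair:
  assumes ind: "indep_var N X L Y" and f [measurable]: "f \<in> borel_measurable (N \<Otimes>\<^sub>M L)"
  shows "(\<integral>\<^sup>+\<omega>. f (X \<omega>, Y \<omega>) \<partial>M) = (\<integral>\<^sup>+a. \<integral>\<^sup>+b. f (a, b) \<partial>distr M L Y \<partial>distr M N X)"
proof -
  have [measurable]: "X \<in> M \<rightarrow>\<^sub>M N" "Y \<in> M \<rightarrow>\<^sub>M L"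
    using ind by (auto dest: indep_var_rv1 indep_var_rv2)
  interpret Y: prob_space "distr M L Y"
    by (rule prob_space_distr) measurable
  have "(\<integral>\<^sup>+\<omega>. f (X \<omega>, Y \<omega>) \<partial>M) = (\<integral>\<^sup>+p. f p \<partial>distr M (N \<Otimes>\<^sub>M L) (\<lambda>\<omega>. (X \<omega>, Y \<omega>)))"
    by (subst nn_integral_distr) auto
  also have "\<dots> = (\<integral>\<^sup>+p. f p \<partial>(distr M N X \<Otimes>\<^sub>M distr M L Y))"
    using ind unfolding indep_var_distribution_eq by simp
  also have "\<dots> = (\<integral>\<^sup>+a. \<integral>\<^sup>+b. f (a, b) \<partial>distr M L Y \<partial>distr M N X)"
    by (rule Y.nn_integral_fst[symmetric]) measurable
  finally show ?thesis .
qed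

text \<open>Meant for interarrival times \<open>A\<close> and services \<open>B\<close>, each split
  into past (1) and next (2). Independence between the two families and within each makes all four
  factors independent, so the next pair can be integrated out with the past held fixed.\<close>

lemma (in prob_space) nn_integral_indep_quadruple:
  assumes indAB: "indep_var (N1 \<Otimes>\<^sub>M N2) (\<lambda>\<omega>. (A1 \<omega>, A2 \<omega>)) (L1 \<Otimes>\<^sub>M L2) (\<lambda>\<omega>. (B1 \<omega>, B2 \<omega>))"
    and indA: "indep_var N1 A1 N2 A2" and indB: "indep_var L1 B1 L2 B2"
    and f [measurable]: "f \<in> borel_measurable ((N1 \<Otimes>\<^sub>M L1) \<Otimes>\<^sub>M (N2 \<Otimes>\<^sub>M L2))"
  shows "(\<integral>\<^sup>+\<omega>. f ((A1 \<omega>, B1 \<omega>), (A2 \<omega>, B2 \<omega>)) \<partial>M) =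
    (\<integral>\<^sup>+\<omega>. \<integral>\<^sup>+a. \<integral>\<^sup>+b. f ((A1 \<omega>, B1 \<omega>), (a, b)) \<partial>distr M L2 B2 \<partial>distr M N2 A2 \<partial>M)"
proof -
  have [measurable]: "A1 \<in> M \<rightarrow>\<^sub>M N1" "A2 \<in> M \<rightarrow>\<^sub>M N2" "B1 \<in> M \<rightarrow>\<^sub>M L1" "B2 \<in> M \<rightarrow>\<^sub>M L2"
    using indA indB by (auto dest: indep_var_rv1 indep_var_rv2)
  interpret A1: prob_space "distr M N1 A1" by (rule prob_space_distr) measurable
  interpret A2: prob_space "distr M N2 A2" by (rule prob_space_distr) measurable
  interpret B1: prob_space "distr M L1 B1" by (rule prob_space_distr) measurable
  interpret B2: prob_space "distr M L2 B2" by (rule prob_space_distr) measurable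
  interpret B1A2: pair_sigma_finite "distr M L1 B1" "distr M N2 A2" ..
  have A: "distr M (N1 \<Otimes>\<^sub>M N2) (\<lambda>\<omega>. (A1 \<omega>, A2 \<omega>)) = distr M N1 A1 \<Otimes>\<^sub>M distr M N2 A2"
    and B: "distr M (L1 \<Otimes>\<^sub>M L2) (\<lambda>\<omega>. (B1 \<omega>, B2 \<omega>)) = distr M L1 B1 \<Otimes>\<^sub>M distr M L2 B2"
    using indA indB unfolding indep_var_distribution_eq by simp_all
  have "(\<integral>\<^sup>+\<omega>. f ((A1 \<omega>, B1 \<omega>), (A2 \<omega>, B2 \<omega>)) \<partial>M)
    = (\<integral>\<^sup>+p. \<integral>\<^sup>+q. f ((fst p, fst q), (snd p, snd q)) \<partial>(distr M L1 B1 \<Otimes>\<^sub>M distr M L2 B2) \<partial>(distr M N1 A1 \<Otimes>\<^sub>M distr M N2 A2))"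
    using nn_integral_indep_pair[OF indAB, of "\<lambda>(p, q). f ((fst p, fst q), (snd p, snd q))"]
    by (simp add: A B)
  also have "\<dots> = (\<integral>\<^sup>+a1. \<integral>\<^sup>+a2. \<integral>\<^sup>+b1. \<integral>\<^sup>+b2. f ((a1, b1), (a2, b2))
      \<partial>distr M L2 B2 \<partial>distr M L1 B1 \<partial>distr M N2 A2 \<partial>distr M N1 A1)"
  proof -
    have "(\<integral>\<^sup>+q. f ((fst p, fst q), (snd p, snd q)) \<partial>(distr M L1 B1 \<Otimes>\<^sub>M distr M L2 B2))
      = (\<integral>\<^sup>+b1. \<integral>\<^sup>+b2. f ((fst p, b1), (snd p, b2)) \<partial>distr M L2 B2 \<partial>distr M L1 B1)"
      if "p \<in> space (N1 \<Otimes>\<^sub>M N2)" for p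
    proof -
      have [measurable]: "fst p \<in> space N1" "snd p \<in> space N2"
        using that by (auto simp: space_pair_measure)
      show ?thesis
        using B2.nn_integral_fst[of "\<lambda>q. f ((fst p, fst q), (snd p, snd q))" "distr M L1 B1"] by simp
    qed
    then have "(\<integral>\<^sup>+p. \<integral>\<^sup>+q. f ((fst p, fst q), (snd p, snd q)) \<partial>(distr M L1 B1 \<Otimes>\<^sub>M distr M L2 B2) \<partial>(distr M N1 A1 \<Otimes>\<^sub>M distr M N2 A2))
      = (\<integral>\<^sup>+p. \<integral>\<^sup>+b1. \<integral>\<^sup>+b2. f ((fst p, b1), (snd p, b2)) \<partial>distr M L2 B2 \<partial>distr M L1 B1 \<partial>(distr M N1 A1 \<Otimes>\<^sub>M distr M N2 A2))"
      by (intro nn_integral_cong) (simp add: space_pair_measure)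
    also have "\<dots> = (\<integral>\<^sup>+a1. \<integral>\<^sup>+a2. \<integral>\<^sup>+b1. \<integral>\<^sup>+b2. f ((a1, b1), (a2, b2))
      \<partial>distr M L2 B2 \<partial>distr M L1 B1 \<partial>distr M N2 A2 \<partial>distr M N1 A1)"
      using A2.nn_integral_fst[of "\<lambda>p. \<integral>\<^sup>+b1. \<integral>\<^sup>+b2. f ((fst p, b1), (snd p, b2)) \<partial>distr M L2 B2 \<partial>distr M L1 B1" "distr M N1 A1"]
      by simp
    finally show ?thesis .
  qed
  \<comment> \<open>Exchange \<open>b1\<close> and \<open>a2\<close>, so that the two past variables
    stand outermost.\<close>
  also have "\<dots> = (\<integral>\<^sup>+a1. \<integral>\<^sup>+b1. \<integral>\<^sup>+a2. \<integral>\<^sup>+b2. f ((a1, b1), (a2, b2))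
      \<partial>distr M L2 B2 \<partial>distr M N2 A2 \<partial>distr M L1 B1 \<partial>distr M N1 A1)"
  proof (rule nn_integral_cong)
    fix a1 assume "a1 \<in> space (distr M N1 A1)"
    then have [measurable]: "a1 \<in> space N1" by simp
    show "(\<integral>\<^sup>+a2. \<integral>\<^sup>+b1. \<integral>\<^sup>+b2. f ((a1, b1), (a2, b2)) \<partial>distr M L2 B2 \<partial>distr M L1 B1 \<partial>distr M N2 A2)
      = (\<integral>\<^sup>+b1. \<integral>\<^sup>+a2. \<integral>\<^sup>+b2. f ((a1, b1), (a2, b2)) \<partial>distr M L2 B2 \<partial>distr M N2 A2 \<partial>distr M L1 B1)"
      by (rule B1A2.Fubini') measurable
  qed
  also have "\<dots> = (\<integral>\<^sup>+\<omega>. \<integral>\<^sup>+a. \<integral>\<^sup>+b. f ((A1 \<omega>, B1 \<omega>), (a, b)) \<partial>distr M L2 B2 \<partial>distr M N2 A2 \<partial>M)"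
  proof -
    have "indep_var N1 (fst \<circ> (\<lambda>\<omega>. (A1 \<omega>, A2 \<omega>))) L1 (fst \<circ> (\<lambda>\<omega>. (B1 \<omega>, B2 \<omega>)))"
      by (rule indep_var_compose[OF indAB]) measurable
    then have "indep_var N1 A1 L1 B1"
      by (simp add: comp_def)
    from nn_integral_indep_pair[OF this, of "\<lambda>p. \<integral>\<^sup>+a. \<integral>\<^sup>+b. f (p, (a, b)) \<partial>distr M L2 B2 \<partial>distr M N2 A2"]
    show ?thesis by simp
  qed
  finally show ?thesis .
qed

section \<open>The arrival chain of the queue\<close>

lemma workload_arr_cong:
  assumes "\<And>k. k \<le> n \<Longrightarrow> T k = T' k" "\<And>k. 1 \<le> k \<Longrightarrow> k \<le> n \<Longrightarrow> S k = S' k"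
  shows "workload_arr T S x n = workload_arr T' S' x n"
  using assms by (induction n) (simp_all add: Let_def)

locale mg1_integrable = mg1 +
  assumes integrable_S: "integrable M (S 1)"
begin

lemma T_measurable [measurable]: "T n \<in> borel_measurable M"
proof -
  have "(\<lambda>\<omega> n. T n \<omega>) \<in> M \<rightarrow>\<^sub>M (\<Pi>\<^sub>M i\<in>UNIV. borel)"
    using T_S_indep by (rule indep_var_rv1)
  from measurable_compose[OF this measurable_component_singleton[of n]] show ?thesis
    by simp
qed

lemma S_measurable [measurable (raw)]: "1 \<le> n \<Longrightarrow> S n \<in> borel_measurable M"
  using S_indep by (auto simp: indep_vars_def)

lemma integrable_G: "integrable G (\<lambda>y. y)"
  and mean_G: "(\<integral>y. y \<partial>G) = expectation (S 1)"
proof -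
  show "integrable G (\<lambda>y. y)"
    unfolding S_distr[OF order.refl, symmetric] by (subst integrable_distr_eq) (use integrable_S in auto)
  show "(\<integral>y. y \<partial>G) = expectation (S 1)"
    unfolding S_distr[OF order.refl, symmetric] by (subst integral_distr) auto
qed

sublocale law: service_law G lam
  using prob_G lam_pos sets_G G_pos integrable_G
  by (simp add: service_law_def service_law_axioms_def)

abbreviation interarrival :: "nat \<Rightarrow> 'a \<Rightarrow> real" where
  "interarrival n \<omega> \<equiv> T n \<omega> - T (n - 1) \<omega>"

lemma distr_interarrival:
  assumes "1 \<le> n"
  shows "distr M borel (interarrival n) = law.exp_law"
proof -
  have "distr M lborel (interarrival n) = law.exp_law"
    using interarrival_exp[OF assms] by (simp add: distributed_def law.exp_law_def)
  moreover have "distr M lborel (interarrival n) = distr M borel (interarrival n)"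
    by (rule distr_cong) auto
  ultimately show ?thesis by simp
qed

definition arrival_state :: "real \<Rightarrow> nat \<Rightarrow> 'a \<Rightarrow> real \<times> real" where
  "arrival_state x n \<omega> = (workload_arr (\<lambda>k. T k \<omega>) (\<lambda>k. S k \<omega>) x n, T n \<omega>)"

lemma arrival_state_0: "\<omega> \<in> space M \<Longrightarrow> arrival_state x 0 \<omega> = (x, 0)"
  by (simp add: arrival_state_def T_0)

lemma arrival_state_Suc: "arrival_state x (Suc n) \<omega> = law.step (arrival_state x n \<omega>) (interarrival (Suc n) \<omega>) (S (Suc n) \<omega>)"
  by (simp add: arrival_state_def law.step_def law.jump_def Let_def)

lemma arrival_state_measurable [measurable]: "arrival_state x n \<in> M \<rightarrow>\<^sub>M borel \<Otimes>\<^sub>M borel"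
proof (induction n)
  case 0
  have "(\<lambda>\<omega>. (x, T 0 \<omega>)) \<in> M \<rightarrow>\<^sub>M borel \<Otimes>\<^sub>M borel" by measurable
  then show ?case by (simp add: arrival_state_def[abs_def])
next
  case (Suc n)
  note [measurable] = Suc
  have "(\<lambda>\<omega>. law.step (arrival_state x n \<omega>) (interarrival (Suc n) \<omega>) (S (Suc n) \<omega>)) \<in> M \<rightarrow>\<^sub>M borel \<Otimes>\<^sub>M borel"
    by measurable
  then show ?case by (simp add: arrival_state_Suc[abs_def])
qed

text \<open>Rebuilds the \<open>n\<close>-th arrival state from the first \<open>n\<close>
  interarrival times and services, with epochs as partial sums since \<open>T 0 = 0\<close>. This
  exhibits the past as a measurable function of variables independent of the next pair.\<close>

definition state_of :: "real \<Rightarrow> nat \<Rightarrow> (nat \<Rightarrow> real) \<times> (nat \<Rightarrow> real) \<Rightarrow> real \<times> real" where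
  "state_of x n p = (workload_arr (\<lambda>k. \<Sum>i=1..k. fst p i) (snd p) x n, \<Sum>i=1..n. fst p i)"

lemma state_of_measurable:
  "state_of x n \<in> (\<Pi>\<^sub>M i\<in>{1..n}. borel) \<Otimes>\<^sub>M (\<Pi>\<^sub>M i\<in>{1..n}. borel) \<rightarrow>\<^sub>M borel \<Otimes>\<^sub>M borel"
proof -
  let ?N = "(\<Pi>\<^sub>M i\<in>{1..n}. borel) \<Otimes>\<^sub>M (\<Pi>\<^sub>M i\<in>{1..n}. borel) :: ((nat \<Rightarrow> real) \<times> (nat \<Rightarrow> real)) measure"
  have c1: "(\<lambda>p. fst p i) \<in> borel_measurable ?N" and c2: "(\<lambda>p. snd p i) \<in> borel_measurable ?N"
    if "i \<in> {1..n}" for i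
    using that by (auto intro: measurable_compose[OF measurable_fst measurable_component_singleton[of i]]
        measurable_compose[OF measurable_snd measurable_component_singleton[of i]])
  have sum: "(\<lambda>p. \<Sum>i=1..k. fst p i) \<in> borel_measurable ?N" if "k \<le> n" for k
    by (rule borel_measurable_sum) (use that c1 in auto)
  have "(\<lambda>p. workload_arr (\<lambda>k. \<Sum>i=1..k. fst p i) (snd p) x m) \<in> borel_measurable ?N" if "m \<le> n" for m
    using that
  proof (induction m)
    case (Suc m)
    have [measurable]: "(\<lambda>p. workload_arr (\<lambda>k. \<Sum>i=1..k. fst p i) (snd p) x m) \<in> borel_measurable ?N"
      "(\<lambda>p. \<Sum>i=1..m. fst p i) \<in> borel_measurable ?N"
      "(\<lambda>p. \<Sum>i=1..Suc m. fst p i) \<in> borel_measurable ?N" "(\<lambda>p. snd p (Suc m)) \<in> borel_measurable ?N"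
      using Suc c2 sum by auto
    show ?case
      unfolding workload_arr.simps Let_def by measurable
  qed simp
  from this[OF order.refl] sum[OF order.refl] show ?thesis
    unfolding state_of_def[abs_def] by (rule measurable_Pair)
qed

lemma arrival_state_eq_state_of:
  assumes "\<omega> \<in> space M"
  shows "arrival_state x n \<omega> = state_of x n (\<lambda>i\<in>{1..n}. interarrival i \<omega>, \<lambda>i\<in>{1..n}. S i \<omega>)"
proof -
  have T: "T k \<omega> = (\<Sum>i=1..k. (\<lambda>i\<in>{1..n}. interarrival i \<omega>) i)" if "k \<le> n" for k
    using that by (induction k) (auto simp: T_0[OF assms])
  have "workload_arr (\<lambda>k. T k \<omega>) (\<lambda>k. S k \<omega>) x n
    = workload_arr (\<lambda>k. \<Sum>i=1..k. (\<lambda>i\<in>{1..n}. interarrival i \<omega>) i) (\<lambda>i\<in>{1..n}. S i \<omega>) x n"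
    by (rule workload_arr_cong) (use T in auto)
  then show ?thesis
    using T[of n] by (simp add: arrival_state_def state_of_def del: restrict_apply)
qed

text \<open>The Markov property of the arrival chain: the next interarrival time and service are
  independent of the current state and of each other.\<close>

lemma nn_integral_next:
  assumes f [measurable]: "(\<lambda>(w, e, y). f w e y) \<in> borel_measurable ((borel \<Otimes>\<^sub>M borel) \<Otimes>\<^sub>M (borel \<Otimes>\<^sub>M borel))"
  shows "(\<integral>\<^sup>+\<omega>. f (arrival_state x n \<omega>) (interarrival (Suc n) \<omega>) (S (Suc n) \<omega>) \<partial>M) =
    (\<integral>\<^sup>+\<omega>. \<integral>\<^sup>+e. \<integral>\<^sup>+y. f (arrival_state x n \<omega>) e y \<partial>G \<partial>law.exp_law \<partial>M)"
proof -
  let ?I = "{1..n}" and ?P = "\<Pi>\<^sub>M i\<in>{1..n}. (borel :: real measure)" and ?R = "\<Pi>\<^sub>M i\<in>{Suc n}. (borel :: real measure)"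
  let ?A1 = "\<lambda>\<omega>. \<lambda>i\<in>?I. interarrival i \<omega>" and ?A2 = "\<lambda>\<omega>. \<lambda>i\<in>{Suc n}. interarrival i \<omega>"
  let ?B1 = "\<lambda>\<omega>. \<lambda>i\<in>?I. S i \<omega>" and ?B2 = "\<lambda>\<omega>. \<lambda>i\<in>{Suc n}. S i \<omega>"
  have indA: "indep_var ?P ?A1 ?R ?A2"
    by (rule indep_var_restrict[OF interarrival_indep]) auto
  have indB: "indep_var ?P ?B1 ?R ?B2"
    by (rule indep_var_restrict[OF S_indep]) auto
  have [measurable]: "?A2 \<in> M \<rightarrow>\<^sub>M ?R" "?B2 \<in> M \<rightarrow>\<^sub>M ?R"
    using indA indB by (auto dest: indep_var_rv2)
  have comp [measurable]: "(\<lambda>x. x (Suc n)) \<in> ?R \<rightarrow>\<^sub>M borel"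
    by (rule measurable_component_singleton) auto
  have A2: "(\<integral>\<^sup>+a. g (a (Suc n)) \<partial>distr M ?R ?A2) = (\<integral>\<^sup>+e. g e \<partial>law.exp_law)"
    if [measurable]: "g \<in> borel_measurable borel" for g :: "real \<Rightarrow> ennreal"
  proof -
    have "(\<integral>\<^sup>+a. g (a (Suc n)) \<partial>distr M ?R ?A2) = (\<integral>\<^sup>+\<omega>. g (interarrival (Suc n) \<omega>) \<partial>M)"
      by (subst nn_integral_distr) auto
    also have "\<dots> = (\<integral>\<^sup>+e. g e \<partial>distr M borel (interarrival (Suc n)))"
      by (subst nn_integral_distr) auto
    finally show ?thesis
      by (subst (asm) distr_interarrival) auto
  qed
  have B2: "(\<integral>\<^sup>+a. g (a (Suc n)) \<partial>distr M ?R ?B2) = (\<integral>\<^sup>+y. g y \<partial>G)"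
    if [measurable]: "g \<in> borel_measurable borel" for g :: "real \<Rightarrow> ennreal"
  proof -
    have "(\<integral>\<^sup>+a. g (a (Suc n)) \<partial>distr M ?R ?B2) = (\<integral>\<^sup>+\<omega>. g (S (Suc n) \<omega>) \<partial>M)"
      by (subst nn_integral_distr) auto
    also have "\<dots> = (\<integral>\<^sup>+y. g y \<partial>distr M borel (S (Suc n)))"
      by (subst nn_integral_distr) auto
    finally show ?thesis
      by (subst (asm) S_distr) auto
  qed
  \<comment> \<open>Independence is assumed between the epochs and the services; differences of
    epochs and restrictions to index sets are measurable images of these.\<close>
  have indAB: "indep_var (?P \<Otimes>\<^sub>M ?R) (\<lambda>\<omega>. (?A1 \<omega>, ?A2 \<omega>)) (?P \<Otimes>\<^sub>M ?R) (\<lambda>\<omega>. (?B1 \<omega>, ?B2 \<omega>))"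
  proof -
    let ?Y1 = "\<lambda>\<tau> :: nat \<Rightarrow> real. (\<lambda>i\<in>?I. \<tau> i - \<tau> (i - 1), \<lambda>i\<in>{Suc n}. \<tau> i - \<tau> (i - 1))"
    let ?Y2 = "\<lambda>\<sigma> :: nat \<Rightarrow> real. (\<lambda>i\<in>?I. \<sigma> i, \<lambda>i\<in>{Suc n}. \<sigma> i)"
    have "indep_var (?P \<Otimes>\<^sub>M ?R) (?Y1 \<circ> (\<lambda>\<omega> n. T n \<omega>)) (?P \<Otimes>\<^sub>M ?R) (?Y2 \<circ> (\<lambda>\<omega>. \<lambda>n\<in>{1..}. S n \<omega>))"
    proof (rule indep_var_compose[OF T_S_indep])
      show "?Y1 \<in> (\<Pi>\<^sub>M i\<in>UNIV. borel) \<rightarrow>\<^sub>M ?P \<Otimes>\<^sub>M ?R"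
        by (intro measurable_Pair measurable_restrict borel_measurable_diff measurable_component_singleton) auto
      show "?Y2 \<in> (\<Pi>\<^sub>M i\<in>{1..}. borel) \<rightarrow>\<^sub>M ?P \<Otimes>\<^sub>M ?R"
        by (intro measurable_Pair measurable_restrict measurable_component_singleton) auto
    qed
    also have "?Y1 \<circ> (\<lambda>\<omega> n. T n \<omega>) = (\<lambda>\<omega>. (?A1 \<omega>, ?A2 \<omega>))"
      by (simp add: comp_def)
    also have "?Y2 \<circ> (\<lambda>\<omega>. \<lambda>n\<in>{1..}. S n \<omega>) = (\<lambda>\<omega>. (?B1 \<omega>, ?B2 \<omega>))"
      by (auto simp: fun_eq_iff restrict_def)
    finally show ?thesis .
  qed
  let ?f = "\<lambda>p. f (state_of x n (fst p)) (fst (snd p) (Suc n)) (snd (snd p) (Suc n))"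
  have [measurable]: "?f \<in> borel_measurable ((?P \<Otimes>\<^sub>M ?P) \<Otimes>\<^sub>M (?R \<Otimes>\<^sub>M ?R))"
  proof -
    note [measurable] = state_of_measurable
    have "(\<lambda>(w, e, y). f w e y) \<circ> (\<lambda>p. (state_of x n (fst p), fst (snd p) (Suc n), snd (snd p) (Suc n)))
       \<in> borel_measurable ((?P \<Otimes>\<^sub>M ?P) \<Otimes>\<^sub>M (?R \<Otimes>\<^sub>M ?R))"
      by (rule measurable_comp[OF _ f]) measurable
    then show ?thesis by (simp add: comp_def)
  qed
  have f2 [measurable]: "(\<lambda>p. f w (fst p) (snd p)) \<in> borel_measurable (borel \<Otimes>\<^sub>M borel)" for w
  proof -
    have "(\<lambda>(w, e, y). f w e y) \<circ> (\<lambda>p. (w, fst p, snd p)) \<in> borel_measurable (borel \<Otimes>\<^sub>M borel)"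
      by (rule measurable_comp[OF _ f])
         (intro measurable_Pair measurable_const measurable_fst measurable_snd, simp add: space_pair_measure)
    then show ?thesis by (simp add: comp_def)
  qed
  have f3: "f w e \<in> borel_measurable borel" for w e
  proof -
    have "(\<lambda>y. (\<lambda>p. f w (fst p) (snd p)) (e, y)) \<in> borel_measurable borel"
      by measurable
    then show ?thesis by simp
  qed
  have f4: "(\<lambda>e. \<integral>\<^sup>+y. f w e y \<partial>G) \<in> borel_measurable borel" for w
  proof -
    have "(\<lambda>e. \<integral>\<^sup>+y. (\<lambda>p. f w (fst p) (snd p)) (e, y) \<partial>G) \<in> borel_measurable borel"
      by measurable
    then show ?thesis by simp
  qed
  have "(\<integral>\<^sup>+\<omega>. f (arrival_state x n \<omega>) (interarrival (Suc n) \<omega>) (S (Suc n) \<omega>) \<partial>M)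
    = (\<integral>\<^sup>+\<omega>. ?f ((?A1 \<omega>, ?B1 \<omega>), (?A2 \<omega>, ?B2 \<omega>)) \<partial>M)"
    by (intro nn_integral_cong) (simp add: arrival_state_eq_state_of)
  also have "\<dots> = (\<integral>\<^sup>+\<omega>. \<integral>\<^sup>+a. \<integral>\<^sup>+b. ?f ((?A1 \<omega>, ?B1 \<omega>), (a, b)) \<partial>distr M ?R ?B2 \<partial>distr M ?R ?A2 \<partial>M)"
    by (rule nn_integral_indep_quadruple[OF indAB indA indB]) measurable
  also have "\<dots> = (\<integral>\<^sup>+\<omega>. \<integral>\<^sup>+a. \<integral>\<^sup>+b. f (arrival_state x n \<omega>) (a (Suc n)) (b (Suc n)) \<partial>distr M ?R ?B2 \<partial>distr M ?R ?A2 \<partial>M)"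
    by (intro nn_integral_cong) (simp add: arrival_state_eq_state_of)
  also have "\<dots> = (\<integral>\<^sup>+\<omega>. \<integral>\<^sup>+e. \<integral>\<^sup>+y. f (arrival_state x n \<omega>) e y \<partial>G \<partial>law.exp_law \<partial>M)"
    by (simp only: B2[OF f3] A2[OF f4])
  finally show ?thesis .
qed

text \<open>Iterated Markov property. The last step is integrated out first, which replaces
  \<open>g\<close> by \<open>next_mean g\<close>; hence the induction is over all
  \<open>g\<close>.\<close>

lemma nn_integral_arrival_state:
  assumes "g \<in> borel_measurable (borel \<Otimes>\<^sub>M borel)"
  shows "(\<integral>\<^sup>+\<omega>. g (arrival_state x n \<omega>) \<partial>M) = (law.next_mean ^^ n) g (x, 0)"
  using assms
proof (induction n arbitrary: g)
  case 0
  have "(\<integral>\<^sup>+\<omega>. g (arrival_state x 0 \<omega>) \<partial>M) = (\<integral>\<^sup>+\<omega>. g (x, 0) \<partial>M)"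
    by (intro nn_integral_cong) (simp add: arrival_state_0)
  then show ?case by (simp add: emeasure_space_1)
next
  case (Suc n)
  note [measurable] = Suc.prems
  have "(\<integral>\<^sup>+\<omega>. g (arrival_state x (Suc n) \<omega>) \<partial>M) = (\<integral>\<^sup>+\<omega>. law.next_mean g (arrival_state x n \<omega>) \<partial>M)"
    unfolding arrival_state_Suc law.next_mean_def by (rule nn_integral_next) (simp add: case_prod_beta)
  also have "\<dots> = (law.next_mean ^^ n) (law.next_mean g) (x, 0)"
    by (rule Suc.IH) measurable
  finally show ?case by (simp add: funpow_swap1)
qed

section \<open>Epochs increase without bound\<close>

lemma AE_strict_mono: "AE \<omega> in M. strict_mono (\<lambda>n. T n \<omega>)"
proof -
  have "AE \<omega> in M. 0 < interarrival (Suc n) \<omega>" for n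
  proof -
    have "AE e in distr M borel (interarrival (Suc n)). 0 < e"
      using law.AE_exp_law_pos by (subst distr_interarrival) auto
    then show ?thesis
      by (subst (asm) AE_distr_iff) auto
  qed
  then have "AE \<omega> in M. \<forall>n. 0 < interarrival (Suc n) \<omega>"
    by (simp add: AE_all_countable)
  then show ?thesis
    by eventually_elim (simp add: strict_mono_Suc_iff)
qed

text \<open>If all epochs were at most \<open>t\<close> with probability \<open>?p\<close>, each of
  the first \<open>n\<close> arrivals would contribute at least \<open>?p\<close> to the mean number
  of arrivals up to \<open>t\<close>. Thus \<open>n * ?p\<close> is at most \<open>lam * t\<close>
  for every \<open>n\<close>, which forces \<open>?p = 0\<close>.\<close>

lemma AE_unbounded:
  assumes "0 \<le> t"
  shows "AE \<omega> in M. \<exists>n. t < T n \<omega>"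
proof -
  let ?g = "\<lambda>w :: real \<times> real. indicator {..t} (snd w) :: ennreal"
  let ?p = "emeasure M {\<omega> \<in> space M. \<forall>n. T n \<omega> \<le> t}"
  have start_mean: "?p \<le> law.start_mean ((law.next_mean ^^ k) ?g)" for k
  proof -
    \<comment> \<open>The epochs do not depend on the initial workload \<open>x\<close>, so the
      bound holds for every \<open>x\<close> and can be averaged over \<open>stat\<close>.\<close>
    have "?p \<le> (\<integral>\<^sup>+\<omega>. ?g (arrival_state x k \<omega>) \<partial>M)" for x
      by (subst nn_integral_indicator[symmetric])
         (auto simp: arrival_state_def indicator_def simp del: nn_integral_indicator intro!: nn_integral_mono)
    then have "?p \<le> (law.next_mean ^^ k) ?g (x, 0)" for x
      by (subst (asm) nn_integral_arrival_state) measurable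
    then have "(\<integral>\<^sup>+v. ?p \<partial>law.stat) \<le> law.start_mean ((law.next_mean ^^ k) ?g)"
      unfolding law.start_mean_def by (intro nn_integral_mono)
    then show ?thesis
      by (simp add: law.stat.emeasure_space_1)
  qed
  have bound: "of_nat n * ?p \<le> ennreal (lam * t)" for n
  proof -
    have "of_nat n * ?p = (\<Sum>k<n. ?p)" by simp
    also have "\<dots> \<le> (\<Sum>k<n. law.start_mean ((law.next_mean ^^ Suc k) ?g))"
      by (intro sum_mono start_mean)
    also have "\<dots> \<le> law.arrival_mean ?g"
      by (rule law.sum_next_mean_le_arrival_mean) measurable
    finally show ?thesis
      by (simp add: law.arrival_mean_counting[OF assms])
  qed
  have "measure M {\<omega> \<in> space M. \<forall>n. T n \<omega> \<le> t} = 0" (is "?m = 0")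
  proof (rule ccontr)
    assume "?m \<noteq> 0"
    then have "0 < ?m" by (simp add: zero_less_measure_iff)
    then obtain n :: nat where "lam * t < of_nat n * ?m"
      using reals_Archimedean3 by blast
    moreover have "ennreal (of_nat n * ?m) \<le> ennreal (lam * t)"
      using bound[of n] by (simp add: emeasure_eq_measure ennreal_mult ennreal_of_nat_eq_real_of_nat)
    ultimately show False
      using lam_pos assms by (simp add: ennreal_le_iff)
  qed
  then show ?thesis
    by (subst AE_iff_measurable[OF _ refl]) (auto simp: emeasure_eq_measure not_less)
qed

section \<open>The distribution at a fixed time and invariance\<close>

lemma V_measurable [measurable]: "V x t \<in> borel_measurable M"
proof -
  have [measurable]: "(\<lambda>\<omega>. arrivals (\<lambda>n. T n \<omega>) t) \<in> M \<rightarrow>\<^sub>M count_space UNIV"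
    unfolding arrivals_def by measurable
  have "(\<lambda>\<omega>. max (fst (arrival_state x (arrivals (\<lambda>n. T n \<omega>) t) \<omega>) - (t - snd (arrival_state x (arrivals (\<lambda>n. T n \<omega>) t) \<omega>))) 0) \<in> borel_measurable M"
    by (rule measurable_compose_countable[where f = "\<lambda>n \<omega>. max (fst (arrival_state x n \<omega>) - (t - snd (arrival_state x n \<omega>))) 0"]) measurable
  then show ?thesis
    by (simp add: V_def[abs_def] workload_def arrival_state_def)
qed

text \<open>Split according to the index of the last epoch up to \<open>t\<close>. Integrating out
  the next interarrival time turns the condition that the next epoch exceeds \<open>t\<close> into
  the factor \<open>exp (- lam * (t - T n))\<close> of \<open>last_epoch\<close>.\<close>

lemma emeasure_V:
  assumes t: "0 \<le> t" and A [measurable]: "A \<in> sets borel"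
  shows "emeasure M {\<omega> \<in> space M. V x t \<omega> \<in> A} = (\<Sum>n. (law.next_mean ^^ n) (law.last_epoch t A) (x, 0))"
proof -
  let ?f = "\<lambda>w e y :: real. indicator {..t} (snd w) * indicator {t<..} (snd w + e) *
    indicator A (max (fst w - (t - snd w)) 0) :: ennreal"
  have "emeasure M {\<omega> \<in> space M. V x t \<omega> \<in> A} = (\<integral>\<^sup>+\<omega>. indicator A (V x t \<omega>) \<partial>M)"
    by (subst nn_integral_indicator[symmetric])
       (auto simp del: nn_integral_indicator simp: indicator_def intro!: nn_integral_cong)
  also have "\<dots> = (\<integral>\<^sup>+\<omega>. (\<Sum>n. ?f (arrival_state x n \<omega>) (interarrival (Suc n) \<omega>) (S (Suc n) \<omega>)) \<partial>M)"
  proof (intro nn_integral_cong_AE, use AE_strict_mono AE_unbounded[OF t] AE_space in eventually_elim)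
    fix \<omega> assume mono: "strict_mono (\<lambda>n. T n \<omega>)" and ex: "\<exists>n. t < T n \<omega>" and \<omega>: "\<omega> \<in> space M"
    \<comment> \<open>The first epoch after \<open>t\<close> exists almost surely and has positive
      index, since \<open>T 0 = 0 \<le> t\<close>; its predecessor is the last epoch up to
      \<open>t\<close>, the only index with a nonzero summand.\<close>
    define m where "m = (LEAST n. t < T n \<omega>)"
    have m: "t < T m \<omega>" unfolding m_def using ex by (rule LeastI_ex)
    with t T_0[OF \<omega>] have "m \<noteq> 0" by (metis not_less)
    then obtain n where n: "m = Suc n" by (cases m) auto
    have "\<not> t < T n \<omega>"
      using not_less_Least[of n "\<lambda>n. t < T n \<omega>"] n by (simp add: m_def)
    then have Tn: "T n \<omega> \<le> t" "t < T (Suc n) \<omega>" using m n by auto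
    have eq: "arrivals (\<lambda>n. T n \<omega>) t = n"
      by (rule arrivals_eq) (use mono Tn in auto)
    have "(\<Sum>k. ?f (arrival_state x k \<omega>) (interarrival (Suc k) \<omega>) (S (Suc k) \<omega>))
      = (\<Sum>k\<in>{n}. ?f (arrival_state x k \<omega>) (interarrival (Suc k) \<omega>) (S (Suc k) \<omega>))"
    proof (rule suminf_finite)
      fix k assume "k \<notin> {n}"
      then have "\<not> (T k \<omega> \<le> t \<and> t < T (Suc k) \<omega>)"
        using arrivals_eq[OF mono, of k t] eq by auto
      then show "?f (arrival_state x k \<omega>) (interarrival (Suc k) \<omega>) (S (Suc k) \<omega>) = 0"
        by (auto simp: arrival_state_def indicator_def)
    qed simp
    then show "indicator A (V x t \<omega>) = (\<Sum>k. ?f (arrival_state x k \<omega>) (interarrival (Suc k) \<omega>) (S (Suc k) \<omega>))"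
      using Tn by (simp add: V_def workload_def eq arrival_state_def)
  qed
  also have "\<dots> = (\<Sum>n. \<integral>\<^sup>+\<omega>. ?f (arrival_state x n \<omega>) (interarrival (Suc n) \<omega>) (S (Suc n) \<omega>) \<partial>M)"
    by (rule nn_integral_suminf) measurable
  also have "\<dots> = (\<Sum>n. (law.next_mean ^^ n) (law.last_epoch t A) (x, 0))"
  proof (rule suminf_cong)
    fix n
    have "(\<integral>\<^sup>+\<omega>. ?f (arrival_state x n \<omega>) (interarrival (Suc n) \<omega>) (S (Suc n) \<omega>) \<partial>M)
      = (\<integral>\<^sup>+\<omega>. \<integral>\<^sup>+e. \<integral>\<^sup>+y. ?f (arrival_state x n \<omega>) e y \<partial>G \<partial>law.exp_law \<partial>M)"
      by (rule nn_integral_next) (simp add: case_prod_beta)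
    also have "\<dots> = (\<integral>\<^sup>+\<omega>. law.last_epoch t A (arrival_state x n \<omega>) \<partial>M)"
    proof (rule nn_integral_cong)
      fix \<omega>
      let ?w = "arrival_state x n \<omega>"
      have "(\<integral>\<^sup>+e. \<integral>\<^sup>+y. ?f ?w e y \<partial>G \<partial>law.exp_law)
        = (\<integral>\<^sup>+e. (indicator {..t} (snd ?w) * indicator A (max (fst ?w - (t - snd ?w)) 0)) * indicator {t - snd ?w<..} e \<partial>law.exp_law)"
        by (intro nn_integral_cong) (auto simp: indicator_def law.emeasure_space_1[simplified])
      also have "\<dots> = (indicator {..t} (snd ?w) * indicator A (max (fst ?w - (t - snd ?w)) 0)) * emeasure law.exp_law {t - snd ?w<..}"
        by (rule nn_integral_cmult_indicator) (simp add: law.sets_exp_law)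
      also have "\<dots> = law.last_epoch t A ?w"
        by (cases "snd ?w \<le> t") (simp_all add: law.exp_law_tail law.last_epoch_def mult.commute)
      finally show "(\<integral>\<^sup>+e. \<integral>\<^sup>+y. ?f ?w e y \<partial>G \<partial>law.exp_law) = law.last_epoch t A ?w" .
    qed
    also have "\<dots> = (law.next_mean ^^ n) (law.last_epoch t A) (x, 0)"
      by (rule nn_integral_arrival_state) measurable
    finally show "(\<integral>\<^sup>+\<omega>. ?f (arrival_state x n \<omega>) (interarrival (Suc n) \<omega>) (S (Suc n) \<omega>) \<partial>M)
      = (law.next_mean ^^ n) (law.last_epoch t A) (x, 0)" .
  qed
  finally show ?thesis .
qed

lemma invariant_stat: "invariant_distribution M V law.stat"
  unfolding invariant_distribution_def
proof (intro conjI allI impI ballI)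
  fix t :: real and A :: "real set" assume t: "0 \<le> t" and A: "A \<in> sets borel"
  define p where "p A x = emeasure M {\<omega> \<in> space M. V x t \<omega> \<in> A}" for A x
  \<comment> \<open>Measurability in the starting point is read off the series, whose terms are
    measurable functions of \<open>x\<close>.\<close>
  have meas: "p A \<in> borel_measurable borel" if [measurable]: "A \<in> sets borel" for A
    unfolding p_def[abs_def] emeasure_V[OF t that] by measurable
  have le: "(\<integral>\<^sup>+x. p A x \<partial>law.stat) \<le> emeasure law.stat A" if [measurable]: "A \<in> sets borel" for A
  proof -
    have "(\<integral>\<^sup>+x. p A x \<partial>law.stat) = (\<Sum>n. law.start_mean ((law.next_mean ^^ n) (law.last_epoch t A)))"
      unfolding p_def emeasure_V[OF t that] law.start_mean_def by (rule nn_integral_suminf) measurable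
    also have "\<dots> \<le> emeasure law.stat A"
      by (rule law.suminf_last_epoch_le_stat) (use t in auto)
    finally show ?thesis .
  qed
  have A': "- A \<in> sets borel" using A by auto
  have total: "p A x + p (- A) x = 1" for x
  proof -
    have "p A x + p (- A) x = emeasure M ({\<omega> \<in> space M. V x t \<omega> \<in> A} \<union> {\<omega> \<in> space M. V x t \<omega> \<in> - A})"
      unfolding p_def using A A' by (intro plus_emeasure) auto
    also have "{\<omega> \<in> space M. V x t \<omega> \<in> A} \<union> {\<omega> \<in> space M. V x t \<omega> \<in> - A} = space M" by auto
    finally show ?thesis by (simp add: emeasure_space_1)
  qed
  \<comment> \<open>The inequality holds for \<open>A\<close> and for its complement, and both sides
    have total mass 1. Cancelling the finite mass of the complement gives the reverse inequality for
    \<open>A\<close>.\<close>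
  have "emeasure law.stat A + emeasure law.stat (- A) = emeasure law.stat (A \<union> - A)"
    using A A' by (intro plus_emeasure) (auto simp: law.sets_stat)
  also have "\<dots> = 1"
    using law.stat.emeasure_space_1 sets_eq_imp_space_eq[OF law.sets_stat] by simp
  also have "\<dots> = (\<integral>\<^sup>+x. p A x + p (- A) x \<partial>law.stat)"
    by (simp add: total law.stat.emeasure_space_1)
  also have "\<dots> = (\<integral>\<^sup>+x. p A x \<partial>law.stat) + (\<integral>\<^sup>+x. p (- A) x \<partial>law.stat)"
    using meas[OF A] meas[OF A'] by (intro nn_integral_add) (simp_all add: law.sets_stat cong: measurable_cong_sets)
  also have "\<dots> \<le> (\<integral>\<^sup>+x. p A x \<partial>law.stat) + emeasure law.stat (- A)"
    by (intro add_left_mono le A')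
  finally have "emeasure law.stat A \<le> (\<integral>\<^sup>+x. p A x \<partial>law.stat)"
    by (simp add: add.commute[of _ "emeasure law.stat (- A)"] ennreal_add_left_cancel_le law.stat.emeasure_eq_measure)
  with le[OF A] show "(\<integral>\<^sup>+x. emeasure M {\<omega> \<in> space M. V x t \<omega> \<in> A} \<partial>law.stat) = emeasure law.stat A"
    by (simp add: p_def)
qed (auto simp: law.sets_stat law.stat_negative law.stat.prob_space_axioms)

end

theorem theorem4:
  fixes M :: "'a measure" and lam :: real and G :: "real measure"
    and T S :: "nat \<Rightarrow> 'a \<Rightarrow> real"
  assumes "mg1 M lam G T S"
    and "integrable M (S 1)"
  shows "\<exists>\<pi>. invariant_distribution M (mg1.V T S) \<pi> \<and>
             has_density_on \<pi> (pi_density lam G (prob_space.expectation M (S 1))) {0<..}"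
proof -
  interpret mg1_integrable M lam G T S
    using assms by (simp add: mg1_integrable_def mg1_integrable_axioms_def)
  show ?thesis
    using invariant_stat law.has_density_on_stat by (auto simp: mean_G)
qed

end
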